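(* MinTimeline$_+$ can be solved in $(k+1)^n2^{O(n)}\,\tau\,(\ell+1)$ time, where $n=|V|$. In particular, MinTimeline$_+$ is fixed-parameter tractable for the parameter $n+k$ and in XP for the parameter $n$.
   Context: A temporal graph $\mathcal{G}=(V,(E_i)_{i\in[\tau]})$ consists of a finite vertex set $V$ and edge sets $E_1,\dots,E_\tau\subseteq\binom{V}{2}$. A $k$-activity timeline is a set $\mathcal{T}\subseteq\{(v,a,b)\in V\times[\tau]\times[\tau]\mid a\le b\}$ with at most $k$ triples $(v,\cdot,\cdot)$ for each $v\in V$; it covers $\mathcal{G}$ if for every $t\in[\tau]$ and $\{u,v\}\in E_t$ there is $(u,a,b)\in\mathcal{T}$ or $(v,a,b)\in\mathcal{T}$ with $a\le t\le b$. MinTimeline$_+$: given $(\mathcal{G},k,\ell)$ with $k,\ell\in\mathbb{N}_0$, decide whether there is a $k$-activity timeline $\mathcal{T}$ covering $\mathcal{G}$ with $\sum_{(v,a,b)\in\mathcal{T}}(b-a)\le\ell$. FPT for parameter $p$: decidable in $g(p)|x|^{O(1)}$ time; XP: decidable in $|x|^{g(p)}$ time, for computable $g$. *)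

theory Defs
  imports Main
begin

definition temporal_graph :: "'v set \<Rightarrow> nat \<Rightarrow> (nat \<Rightarrow> 'v set set) \<Rightarrow> bool" where
  "temporal_graph V \<tau> E \<longleftrightarrow> finite V \<and> 1 \<le> \<tau> \<and>
     (\<forall>t\<in>{1..\<tau>}. \<forall>e\<in>E t. e \<subseteq> V \<and> card e = 2)"

definition activity_timeline :: "nat \<Rightarrow> 'v set \<Rightarrow> nat \<Rightarrow> ('v \<times> nat \<times> nat) set \<Rightarrow> bool" where
  "activity_timeline k V \<tau> T \<longleftrightarrow>
     T \<subseteq> {(v, a, b). v \<in> V \<and> a \<in> {1..\<tau>} \<and> b \<in> {1..\<tau>} \<and> a \<le> b} \<and>
     (\<forall>v\<in>V. card {(a, b). (v, a, b) \<in> T} \<le> k)"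

definition covers :: "('v \<times> nat \<times> nat) set \<Rightarrow> nat \<Rightarrow> (nat \<Rightarrow> 'v set set) \<Rightarrow> bool" where
  "covers T \<tau> E \<longleftrightarrow>
     (\<forall>t\<in>{1..\<tau>}. \<forall>e\<in>E t. \<exists>x\<in>e. \<exists>a b. (x, a, b) \<in> T \<and> a \<le> t \<and> t \<le> b)"

definition MinTimeline_plus :: "'v set \<Rightarrow> nat \<Rightarrow> (nat \<Rightarrow> 'v set set) \<Rightarrow> nat \<Rightarrow> nat \<Rightarrow> bool" where
  "MinTimeline_plus V \<tau> E k L \<longleftrightarrow>
     (\<exists>T. activity_timeline k V \<tau> T \<and> covers T \<tau> E \<and> (\<Sum>(v, a, b)\<in>T. b - a) \<le> L)"

datatype instr =
    LoadConst nat nat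
  | Add nat nat nat
  | Sub nat nat nat
  | LoadInd nat nat
  | StoreInd nat nat
  | JumpZero nat nat
  | Halt

type_synonym ram_state = "nat \<times> (nat \<Rightarrow> nat)"

definition halted :: "instr list \<Rightarrow> ram_state \<Rightarrow> bool" where
  "halted P s \<longleftrightarrow> fst s \<ge> length P \<or> P ! fst s = Halt"

fun exec :: "instr \<Rightarrow> ram_state \<Rightarrow> ram_state" where
  "exec (LoadConst r c) (pc, m) = (pc + 1, m(r := c))"
| "exec (Add r a b) (pc, m) = (pc + 1, m(r := m a + m b))"
| "exec (Sub r a b) (pc, m) = (pc + 1, m(r := m a - m b))"
| "exec (LoadInd r a) (pc, m) = (pc + 1, m(r := m (m a)))"
| "exec (StoreInd a r) (pc, m) = (pc + 1, m(m a := m r))"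
| "exec (JumpZero r j) (pc, m) = (if m r = 0 then j else pc + 1, m)"
| "exec Halt s = s"

definition step :: "instr list \<Rightarrow> ram_state \<Rightarrow> ram_state" where
  "step P s = (if halted P s then s else exec (P ! fst s) s)"

definition run :: "instr list \<Rightarrow> nat \<Rightarrow> ram_state \<Rightarrow> ram_state" where
  "run P t s = (step P ^^ t) s"

definition init :: "nat list \<Rightarrow> ram_state" where
  "init xs = (0, \<lambda>i. if i < length xs then xs ! i else 0)"

definition decides_within :: "instr list \<Rightarrow> nat list \<Rightarrow> nat \<Rightarrow> bool \<Rightarrow> bool" where
  "decides_within P xs T ans \<longleftrightarrow>
     (\<exists>t\<le>T. halted P (run P t (init xs)) \<and> (snd (run P t (init xs)) 0 \<noteq> 0 \<longleftrightarrow> ans))"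

definition computable_fun :: "(nat \<Rightarrow> nat) \<Rightarrow> bool" where
  "computable_fun g \<longleftrightarrow>
     (\<exists>Q. \<forall>p. \<exists>t. halted Q (run Q t (init [p])) \<and> snd (run Q t (init [p])) 0 = g p)"

definition encode :: "nat \<Rightarrow> nat \<Rightarrow> (nat \<Rightarrow> nat set set) \<Rightarrow> nat \<Rightarrow> nat \<Rightarrow> nat list" where
  "encode n \<tau> E k L = [n, \<tau>, k, L] @
     concat (map (\<lambda>t. concat (map (\<lambda>u. map (\<lambda>v. if {u, v} \<in> E t then 1 else 0) [u+1..<n]) [0..<n]))
       [1..<\<tau>+1])"

fun bitlen :: "nat \<Rightarrow> nat" where
  "bitlen x = (if x < 2 then 1 else 1 + bitlen (x div 2))"

definition input_size :: "nat list \<Rightarrow> nat" where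
  "input_size xs = (\<Sum>x\<leftarrow>xs. bitlen x)"

end

theory Submission
  imports Defs
begin

text \<open>
  A vertex needs at most \<open>K = min k \<tau>\<close> intervals, so its history up to a given time is summarised by
  the number of intervals started and by whether it is currently active, that is by one of
  \<open>2 * K + 1\<close> digits. A dynamic program over time stores, for each of the \<open>(2 * K + 1) ^ n\<close> digit
  vectors, the largest budget that can be left. One time step advances the vertices one after
  the other, which needs \<open>n\<close> sweeps through the table with constantly many predecessors per entry,
  and then erases the states whose active vertices do not cover the current snapshot. Storing
  budgets instead of costs makes the running time independent of \<open>L\<close>, and bounding the number of intervals
  by \<open>\<tau>\<close>, which for \<open>n \<ge> 2\<close> is at most the input length, gives the XP bound; for \<open>n \<le> 1\<close> there are no edges.
\<close>

section \<open>Structured programs for the random access machine\<close>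

text \<open>The length \<open>b - a\<close> counts the prolongations of an interval, not the times
  in it. Opening an interval is therefore free, and a vertex may pass from one odd digit to the next
  without charge, closing one interval and opening another in consecutive steps. The intervals of a
  vertex in a timeline may overlap, whereas a digit sequence describes disjoint ones. The
  translation merges them: at most one interval is opened per time step, which is also the source of
  the bound by \<tau>. The machine adds, subtracts and follows pointers, but neither multiplies nor
  divides. Digits and parities cannot be read off a table index cheaply, so an odometer keeps them
  in memory and moves in step with the index, and neighbouring states are found by subtracting
  stored powers. For \<open>n \<le> 1\<close> the input contains no snapshot bits and \<tau> is only
  written in binary, so even a loop over all time steps could be exponential in the input size; this
  is what forces the separate branch.\<close>

datatype com =
    Blk "instr list"
  | Seq com com (infixr ";;" 60)
  | If nat com com
  | While "instr list" nat com

fun csize :: "com \<Rightarrow> nat" where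
  "csize (Blk xs) = length xs"
| "csize (c ;; d) = csize c + csize d"
| "csize (If x c d) = csize c + csize d + 3"
| "csize (While xs x c) = length xs + csize c + 3"

text \<open>The machine has no unconditional jump; cell 63 is reserved to be cleared and tested.\<close>

fun comp :: "nat \<Rightarrow> com \<Rightarrow> instr list" where
  "comp off (Blk xs) = xs"
| "comp off (c ;; d) = comp off c @ comp (off + csize c) d"
| "comp off (If x c d) =
     JumpZero x (off + csize c + 3) # comp (off + 1) c @
     [LoadConst 63 0, JumpZero 63 (off + csize c + csize d + 3)] @
     comp (off + csize c + 3) d"
| "comp off (While xs x c) =
     xs @ JumpZero x (off + length xs + csize c + 3) # comp (off + length xs + 1) c @
     [LoadConst 63 0, JumpZero 63 off]"

lemma length_comp [simp]: "length (comp off c) = csize c"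
  by (induction c arbitrary: off) auto

text \<open>Jump targets are absolute, so a fragment is specified by its position inside an
  arbitrary program. The length bound keeps the machine from halting within the fragment by running
  off the end.\<close>

definition code_at :: "instr list \<Rightarrow> nat \<Rightarrow> instr list \<Rightarrow> bool" where
  "code_at P off xs \<longleftrightarrow> off + length xs \<le> length P \<and> (\<forall>i<length xs. P ! (off + i) = xs ! i)"

lemma code_at_Nil [simp]: "code_at P off [] \<longleftrightarrow> off \<le> length P"
  by (simp add: code_at_def)

lemma code_at_append [simp]:
  "code_at P off (xs @ ys) \<longleftrightarrow> code_at P off xs \<and> code_at P (off + length xs) ys"
proof
  assume *: "code_at P off (xs @ ys)"
  have "P ! (off + length xs + i) = ys ! i" if "i < length ys" for i
    using * that unfolding code_at_def
    by (auto simp: nth_append add.assoc dest: spec[of _ "length xs + i"])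
  moreover have "P ! (off + i) = xs ! i" if "i < length xs" for i
    using * that unfolding code_at_def by (auto simp: nth_append dest: spec[of _ i])
  ultimately show "code_at P off xs \<and> code_at P (off + length xs) ys"
    using * by (auto simp: code_at_def)
next
  assume *: "code_at P off xs \<and> code_at P (off + length xs) ys"
  have "P ! (off + i) = (xs @ ys) ! i" if "i < length xs + length ys" for i
  proof (cases "i < length xs")
    case True
    then show ?thesis using * by (auto simp: code_at_def nth_append)
  next
    case False
    then obtain j where j: "i = length xs + j" by (metis le_Suc_ex not_less)
    then show ?thesis using * that by (auto simp: code_at_def add.assoc)
  qed
  then show "code_at P off (xs @ ys)" using * by (auto simp: code_at_def)
qed

lemma code_at_Cons [simp]:
  "code_at P off (x # xs) \<longleftrightarrow> off < length P \<and> P ! off = x \<and> code_at P (Suc off) xs"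
  using code_at_append[of P off "[x]" xs] by (auto simp: code_at_def)

text \<open>Cells below 64 serve as registers, the remaining ones as heap.\<close>

definition memory :: "(nat \<Rightarrow> nat) \<Rightarrow> (nat \<Rightarrow> nat) \<Rightarrow> nat \<Rightarrow> nat" where
  "memory r h = (\<lambda>a. if a < 64 then r a else h a)"

lemma memory_upd: "a < 64 \<Longrightarrow> (memory r h)(a := x) = memory (r(a := x)) h"
  "\<not> a < 64 \<Longrightarrow> (memory r h)(a := x) = memory r (h(a := x))"
  by (auto simp: memory_def)

text \<open>Total correctness within \<open>T\<close> steps, wherever the code is placed.\<close>

definition wp ::
  "com \<Rightarrow> nat \<Rightarrow> ((nat \<Rightarrow> nat) \<Rightarrow> (nat \<Rightarrow> nat) \<Rightarrow> bool) \<Rightarrow> (nat \<Rightarrow> nat) \<Rightarrow> (nat \<Rightarrow> nat) \<Rightarrow> bool" where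
  "wp c T Q r h \<longleftrightarrow> (\<forall>P off. code_at P off (comp off c) \<longrightarrow>
     (\<exists>t\<le>T. \<exists>r' h'. run P t (off, memory r h) = (off + csize c, memory r' h') \<and> Q r' h'))"

lemma run_add: "run P (s + t) x = run P t (run P s x)"
  unfolding run_def by (simp add: funpow_add add.commute[of s t])

lemma run_0 [simp]: "run P 0 x = x"
  by (simp add: run_def)

lemma run_Suc: "run P (Suc t) x = run P t (step P x)"
  unfolding run_def by (simp add: funpow_swap1)

text \<open>At a \<open>Halt\<close> instruction both \<open>step\<close> and \<open>exec\<close>
  are the identity, so inside the program no case distinction on halting remains.\<close>

lemma step_code [simp]: "pc < length P \<Longrightarrow> step P (pc, m) = exec (P ! pc) (pc, m)"
  by (cases "P ! pc") (auto simp: step_def halted_def)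

lemma wp_mono:
  assumes "wp c T Q r h" "T \<le> T'" "\<And>r h. Q r h \<Longrightarrow> Q' r h"
  shows "wp c T' Q' r h"
  using assms unfolding wp_def by (meson order_trans)

text \<open>Symbolic execution of straight-line code. Direct operands must be registers and pointers
  must lead into the heap, so the two never alias and \<open>r\<close> and \<open>h\<close> are
  updated independently.\<close>

fun blk where
  "blk [] Q r h \<longleftrightarrow> Q r h"
| "blk (LoadConst a c # xs) Q r h \<longleftrightarrow> a < 64 \<and> blk xs Q (r(a := c)) h"
| "blk (Add a b c # xs) Q r h \<longleftrightarrow> a < 64 \<and> b < 64 \<and> c < 64 \<and> blk xs Q (r(a := r b + r c)) h"
| "blk (Sub a b c # xs) Q r h \<longleftrightarrow> a < 64 \<and> b < 64 \<and> c < 64 \<and> blk xs Q (r(a := r b - r c)) h"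
| "blk (LoadInd a b # xs) Q r h \<longleftrightarrow>
     a < 64 \<and> b < 64 \<and> 64 \<le> r b \<and> blk xs Q (r(a := h (r b))) h"
| "blk (StoreInd a b # xs) Q r h \<longleftrightarrow>
     a < 64 \<and> b < 64 \<and> 64 \<le> r a \<and> blk xs Q r (h(r a := r b))"
| "blk (JumpZero a b # xs) Q r h \<longleftrightarrow> False"
| "blk (Halt # xs) Q r h \<longleftrightarrow> False"

lemma blk_append: "blk (xs @ ys) Q r h \<longleftrightarrow> blk xs (blk ys Q) r h"
proof (induction xs arbitrary: r h)
  case (Cons i xs)
  then show ?case by (cases i) (auto simp del: fun_upd_apply)
qed simp

lemma blk_run:
  assumes "blk xs Q r h" "code_at P off xs"
  shows "\<exists>r' h'. run P (length xs) (off, memory r h) = (off + length xs, memory r' h') \<and> Q r' h'"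
  using assms
proof (induction xs arbitrary: off r h)
  case Nil
  then show ?case by (auto)
next
  case (Cons i xs)
  have IH: "\<exists>r' h'. run P (length xs) (Suc off, memory r1 h1) = (Suc off + length xs, memory r' h') \<and> Q r' h'"
    if "blk xs Q r1 h1" for r1 h1
    using Cons.IH[OF that, of "Suc off"] Cons.prems by simp
  obtain r1 h1 where "exec i (off, memory r h) = (Suc off, memory r1 h1)" "blk xs Q r1 h1"
  proof (cases i)
    case (StoreInd a b)
    with Cons.prems(1) have "exec i (off, memory r h) = (Suc off, memory r (h(r a := r b)))"
      by (auto simp: memory_def)
    with Cons.prems(1) StoreInd show ?thesis by (intro that) auto
  qed (use Cons.prems(1) in \<open>auto intro!: that simp: memory_upd\<close>, auto simp: memory_def)
  then show ?case using IH[of r1 h1] Cons.prems by (auto simp: run_Suc)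
qed

lemma wp_Blk: "blk xs Q r h \<Longrightarrow> wp (Blk xs) (length xs) Q r h"
  unfolding wp_def using blk_run by fastforce

lemma wp_Seq: "wp c S (wp d T Q) r h \<Longrightarrow> wp (c ;; d) (S + T) Q r h"
  unfolding wp_def
proof (intro allI impI, goal_cases)
  case (1 P off)
  then obtain s r1 h1 where s: "s \<le> S" "run P s (off, memory r h) = (off + csize c, memory r1 h1)"
    and "\<forall>P off. code_at P off (comp off d) \<longrightarrow>
     (\<exists>t\<le>T. \<exists>r' h'. run P t (off, memory r1 h1) = (off + csize d, memory r' h') \<and> Q r' h')"
    by (auto 0 4)
  moreover have "code_at P (off + csize c) (comp (off + csize c) d)" using 1 by auto
  ultimately obtain t r2 h2 where "t \<le> T"
    "run P t (off + csize c, memory r1 h1) = (off + csize c + csize d, memory r2 h2)" "Q r2 h2"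
    by blast
  with s show ?case
    by (intro exI[of _ "s + t"]) (auto simp: run_add add.assoc)
qed

text \<open>The substitute for an unconditional jump costs two steps and clears cell 63. This side
  effect is the \<open>r(63 := 0)\<close> in the rules for conditionals and loops.\<close>

lemma run_jump_back:
  assumes "code_at P pc [LoadConst 63 0, JumpZero 63 j]"
  shows "run P 2 (pc, memory r h) = (j, memory (r(63 := 0)) h)"
  using assms by (simp add: run_Suc numeral_2_eq_2 memory_upd) (simp add: memory_def)

text \<open>Only the first branch ends in a jump, so only its postcondition sees the cleared cell
  63. The 3 pays for the test and that jump; adding \<open>S\<close> and \<open>T\<close> instead of
  taking their maximum keeps the arithmetic linear.\<close>

lemma wp_If:
  assumes "x < 64"
    and "r x \<noteq> 0 \<Longrightarrow> wp c S (\<lambda>r. Q (r(63 := 0))) r h"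
    and "r x = 0 \<Longrightarrow> wp d T Q r h"
  shows "wp (If x c d) (S + T + 3) Q r h"
  unfolding wp_def
proof (intro allI impI)
  fix P off
  assume code: "code_at P off (comp off (If x c d))"
  have x: "memory r h x = r x" using assms(1) by (simp add: memory_def)
  show "\<exists>t\<le>S + T + 3. \<exists>r' h'. run P t (off, memory r h) = (off + csize (If x c d), memory r' h') \<and> Q r' h'"
  proof (cases "r x = 0")
    case True
    from assms(3)[OF this] code obtain t r' h' where t: "t \<le> T"
      "run P t (off + csize c + 3, memory r h) = (off + csize c + 3 + csize d, memory r' h')" "Q r' h'"
      unfolding wp_def by (fastforce simp: eval_nat_numeral)
    have "run P (Suc t) (off, memory r h) = (off + csize (If x c d), memory r' h')"
      using code True t x by (simp add: run_Suc algebra_simps)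
    with t show ?thesis by (intro exI[of _ "Suc t"]) auto
  next
    case False
    from assms(2)[OF this] code obtain t r' h' where t: "t \<le> S"
      "run P t (Suc off, memory r h) = (Suc off + csize c, memory r' h')" "Q (r'(63 := 0)) h'"
      unfolding wp_def by fastforce
    have "code_at P (Suc off + csize c) [LoadConst 63 0, JumpZero 63 (off + csize c + csize d + 3)]"
      using code by (auto simp: add_ac)
    note jump_back = run_jump_back[OF this]
    have "run P (Suc t + 2) (off, memory r h) = (off + csize (If x c d), memory (r'(63 := 0)) h')"
      unfolding run_add using code False t x jump_back by (simp add: run_Suc)
    with t show ?thesis by (intro exI[of _ "Suc t + 2"]) auto
  qed
qed

text \<open>The index of \<open>I\<close> is the variant, and the body may lower it by any amount.
  The invariant refers to the moment before the condition code \<open>xs\<close>, which runs once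
  more than the body; hence the trailing \<open>length xs + 1\<close>.\<close>

lemma wp_While:
  assumes I: "I N r h"
    and step: "\<And>i r h. I i r h \<Longrightarrow> i \<le> N \<Longrightarrow> blk xs (\<lambda>r h.
      if r x = 0 then Q r h else 0 < i \<and> wp c T (\<lambda>r h. \<exists>j<i. I j (r(63 := 0)) h) r h) r h"
    and x: "x < 64"
  shows "wp (While xs x c) (N * (T + length xs + 3) + length xs + 1) Q r h"
proof -
  have "\<exists>t \<le> i * (T + length xs + 3) + length xs + 1. \<exists>r' h'.
      run P t (off, memory r h) = (off + csize (While xs x c), memory r' h') \<and> Q r' h'"
    if "code_at P off (comp off (While xs x c))" "I i r h" "i \<le> N" for i r h P off
    using that
  proof (induction i arbitrary: r h rule: less_induct)
    case (less i)
    note code = less.prems(1)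
    obtain r1 h1 where 1: "run P (length xs) (off, memory r h) = (off + length xs, memory r1 h1)"
      and cond: "if r1 x = 0 then Q r1 h1 else
        0 < i \<and> wp c T (\<lambda>r h. \<exists>j<i. I j (r(63 := 0)) h) r1 h1"
      using blk_run[OF step[OF less.prems(2,3)], of P off] code by auto
    have x1: "memory r1 h1 x = r1 x" using x by (simp add: memory_def)
    show ?case
    proof (cases "r1 x = 0")
      case True
      then have "run P (length xs + 1) (off, memory r h) = (off + csize (While xs x c), memory r1 h1)"
        unfolding run_add using code 1 x1 by (simp add: run_Suc)
      with True cond show ?thesis by (intro exI[of _ "length xs + 1"]) auto
    next
      case False
      with cond obtain i' where i': "i = Suc i'" by (cases i) auto
      from False cond have "wp c T (\<lambda>r h. \<exists>j<i. I j (r(63 := 0)) h) r1 h1" by simp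
      then obtain t r2 h2 j where t: "t \<le> T" "j < i" "I j (r2(63 := 0)) h2"
        "run P t (off + length xs + 1, memory r1 h1) = (off + length xs + 1 + csize c, memory r2 h2)"
        unfolding wp_def using code by fastforce
      have "code_at P (off + length xs + 1 + csize c) [LoadConst 63 0, JumpZero 63 off]"
        using code by (auto simp: add_ac)
      note jump_back = run_jump_back[OF this]
      have "run P (length xs + Suc t + 2) (off, memory r h) = (off, memory (r2(63 := 0)) h2)"
        unfolding run_add using code False t x1 1 jump_back by (simp add: run_Suc)
      moreover obtain t' r' h' where t': "t' \<le> j * (T + length xs + 3) + length xs + 1"
        "run P t' (off, memory (r2(63 := 0)) h2) = (off + csize (While xs x c), memory r' h')" "Q r' h'"
        using less.IH[OF t(2) code t(3)] t(2) less.prems(3) by (auto simp del: fun_upd_apply)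
      ultimately have "run P (length xs + Suc t + 2 + t') (off, memory r h) =
          (off + csize (While xs x c), memory r' h')"
        unfolding run_add by (simp del: fun_upd_apply)
      moreover have "length xs + Suc t + 2 + t' \<le> i * (T + length xs + 3) + length xs + 1"
      proof -
        have "j * (T + length xs + 3) \<le> i' * (T + length xs + 3)"
          using t(2) i' by (intro mult_right_mono) auto
        then show ?thesis using t(1) t'(1) unfolding i' mult_Suc by linarith
      qed
      ultimately show ?thesis using t' by blast
    qed
  qed
  then show ?thesis unfolding wp_def using I by blast
qed

text \<open>Inner loops use registers with larger numbers, so a single threshold describes what a
  piece of code leaves alone.\<close>

definition keep :: "nat \<Rightarrow> (nat \<Rightarrow> nat) \<Rightarrow> (nat \<Rightarrow> nat) \<Rightarrow> bool" where
  "keep k r r' \<longleftrightarrow> (\<forall>i<k. r' i = r i)"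

lemma keep_refl [simp]: "keep k r r"
  by (simp add: keep_def)

lemma keep_upd [simp]: "k \<le> i \<Longrightarrow> keep k r (r'(i := x)) \<longleftrightarrow> keep k r r'"
  by (auto simp: keep_def)

lemma keep_trans: "keep k r r' \<Longrightarrow> keep l r' r'' \<Longrightarrow> k \<le> l \<Longrightarrow> keep k r r''"
  by (simp add: keep_def)

text \<open>No \<open>Halt\<close> is compiled: control leaves the code at its end, where
  \<open>halted\<close> holds because the counter equals the program length.\<close>

lemma decides_withinI:
  assumes "wp c T (\<lambda>r h. (r 0 \<noteq> 0) = ans) r h" "snd (init xs) = memory r h"
  shows "decides_within (comp 0 c) xs T ans"
proof -
  have "code_at (comp 0 c) 0 (comp 0 c)" by (simp add: code_at_def)
  with assms(1) obtain t r' h' where "t \<le> T"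
    "run (comp 0 c) t (0, memory r h) = (csize c, memory r' h')" "(r' 0 \<noteq> 0) = ans"
    unfolding wp_def by fastforce
  moreover have "init xs = (0, memory r h)" using assms(2) by (simp add: init_def)
  ultimately show ?thesis
    unfolding decides_within_def by (intro exI[of _ t]) (auto simp: halted_def memory_def)
qed

lemma computable_funI:
  assumes "\<And>p r. r 0 = p \<Longrightarrow> \<exists>T. wp c T (\<lambda>r h. r 0 = g p) r (\<lambda>_. 0)"
  shows "computable_fun g"
  unfolding computable_fun_def
proof (intro exI[of _ "comp 0 c"] allI)
  fix p :: nat
  let ?r = "\<lambda>i. if i = 0 then p else (0::nat)"
  obtain T where "wp c T (\<lambda>r h. r 0 = g p) ?r (\<lambda>_. 0)" using assms[of ?r p] by auto
  moreover have "code_at (comp 0 c) 0 (comp 0 c)" by (simp add: code_at_def)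
  ultimately obtain t r' h' where 
    "run (comp 0 c) t (0, memory ?r (\<lambda>_. 0)) = (csize c, memory r' h')" "r' 0 = g p"
    unfolding wp_def by fastforce
  moreover have "init [p] = (0, memory ?r (\<lambda>_. 0))" by (auto simp: init_def memory_def)
  ultimately show "\<exists>t. halted (comp 0 c) (run (comp 0 c) t (init [p])) \<and>
      snd (run (comp 0 c) t (init [p])) 0 = g p"
    by (intro exI[of _ t]) (auto simp: halted_def memory_def)
qed

section \<open>The dynamic program\<close>

text \<open>The state of a vertex is a single digit: \<open>2 * c\<close> if it is inactive and has started \<open>c\<close>
  intervals so far, \<open>2 * c - 1\<close> if it is active in its \<open>c\<close>-th interval. Only staying at an odd
  digit costs something, and digits never decrease.\<close>

definition digit_step :: "nat \<Rightarrow> nat \<Rightarrow> nat \<Rightarrow> bool" where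
  "digit_step e e' c \<longleftrightarrow> e' = e \<and> c = e mod 2 \<or> e' = Suc e \<and> c = 0 \<or> odd e \<and> e' = e + 2 \<and> c = 0"

text \<open>The three arguments of the maximum are the possible predecessors of the digit
  \<open>x v\<close> under \<open>digit_step\<close>. The value 0 for a missing predecessor is
  neutral for the maximum.\<close>

definition relax :: "nat \<Rightarrow> ((nat \<Rightarrow> nat) \<Rightarrow> nat) \<Rightarrow> (nat \<Rightarrow> nat) \<Rightarrow> nat" where
  "relax v F x = max (F x - x v mod 2)
     (max (if 1 \<le> x v then F (x(v := x v - 1)) else 0)
          (if odd (x v) \<and> 2 \<le> x v then F (x(v := x v - 2)) else 0))"

fun relax_upto :: "nat \<Rightarrow> ((nat \<Rightarrow> nat) \<Rightarrow> nat) \<Rightarrow> (nat \<Rightarrow> nat) \<Rightarrow> nat" where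
  "relax_upto 0 F = F"
| "relax_upto (Suc v) F = relax v (relax_upto v F)"

definition covers_at :: "nat \<Rightarrow> nat set set \<Rightarrow> (nat \<Rightarrow> nat) \<Rightarrow> bool" where
  "covers_at n E x \<longleftrightarrow> (\<forall>u v. u < v \<and> v < n \<and> {u, v} \<in> E \<longrightarrow> odd (x u) \<or> odd (x v))"

text \<open>One plus the largest budget that can be left when the state is \<open>x\<close> at time \<open>t\<close>, and 0 if
  \<open>x\<close> cannot be reached within the budget; truncated subtraction then handles infeasibility.\<close>

fun budget :: "nat \<Rightarrow> (nat \<Rightarrow> nat set set) \<Rightarrow> nat \<Rightarrow> nat \<Rightarrow> (nat \<Rightarrow> nat) \<Rightarrow> nat" where
  "budget n E L 0 x = (if x = (\<lambda>_. 0) then Suc L else 0)"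
| "budget n E L (Suc t) x =
     (if covers_at n (E (Suc t)) x then relax_upto n (budget n E L t) x else 0)"

text \<open>The costs are determined by the digits, but as a separate witness they make the total a
  plain double sum. Coordinates from \<open>n\<close> on are frozen, so that states can be compared
  as functions.\<close>

definition is_path ::
  "nat \<Rightarrow> (nat \<Rightarrow> nat set set) \<Rightarrow> nat \<Rightarrow> (nat \<Rightarrow> nat \<Rightarrow> nat) \<Rightarrow> (nat \<Rightarrow> nat \<Rightarrow> nat) \<Rightarrow> bool" where
  "is_path n E t p c \<longleftrightarrow> p 0 = (\<lambda>_. 0) \<and> (\<forall>i<t.
     (\<forall>u<n. digit_step (p i u) (p (Suc i) u) (c i u)) \<and> (\<forall>u\<ge>n. p i u = p (Suc i) u) \<and>
     covers_at n (E (Suc i)) (p (Suc i)))"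

text \<open>Describing a value by its strict lower bounds turns the maximum into an existential
  quantifier and truncated subtraction into addition: \<open>b < F x - c\<close> means
  \<open>b + c < F x\<close>.\<close>

lemma less_relax_iff: "b < relax v F x \<longleftrightarrow> (\<exists>e c. digit_step e (x v) c \<and> b + c < F (x(v := e)))"
proof
  assume "b < relax v F x"
  then consider "b + x v mod 2 < F x" | "1 \<le> x v" "b < F (x(v := x v - 1))"
    | "odd (x v)" "2 \<le> x v" "b < F (x(v := x v - 2))"
    by (auto simp: relax_def less_max_iff_disj less_diff_conv split: if_splits)
  then show "\<exists>e c. digit_step e (x v) c \<and> b + c < F (x(v := e))"
  proof cases
    case 1
    then show ?thesis by (intro exI[of _ "x v"] exI[of _ "x v mod 2"]) (auto simp: digit_step_def)
  next
    case 2
    then show ?thesis by (intro exI[of _ "x v - 1"] exI[of _ 0]) (auto simp: digit_step_def)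
  next
    case 3
    then show ?thesis by (intro exI[of _ "x v - 2"] exI[of _ 0]) (auto simp: digit_step_def)
  qed
next
  assume "\<exists>e c. digit_step e (x v) c \<and> b + c < F (x(v := e))"
  then obtain e c where ec: "digit_step e (x v) c" "b + c < F (x(v := e))" by blast
  from ec(1) consider "e = x v" "c = x v mod 2" | "x v = Suc e" "c = 0"
    | "odd e" "x v = e + 2" "c = 0"
    unfolding digit_step_def by auto
  then show "b < relax v F x"
    using ec(2) by cases (auto simp: relax_def less_max_iff_disj less_diff_conv)
qed

text \<open>Relaxations at different vertices change different coordinates and their costs add up,
  so performing them in succession amounts to one simultaneous step of all vertices below
  \<open>v\<close>.\<close>

lemma less_relax_upto_iff:
  "b < relax_upto v F x \<longleftrightarrow> (\<exists>y c. (\<forall>u<v. digit_step (y u) (x u) (c u)) \<and> (\<forall>u\<ge>v. y u = x u) \<and>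
     b + (\<Sum>u<v. c u) < F y)"
proof (induction v arbitrary: b x)
  case 0
  have "(\<forall>u. y u = x u) \<longleftrightarrow> y = x" for y by auto
  then show ?case by simp
next
  case (Suc v)
  show ?case
  proof
    assume "b < relax_upto (Suc v) F x"
    then obtain e d y c where *: "digit_step e (x v) d" "\<forall>u<v. digit_step (y u) (x u) (c u)"
      "\<forall>u\<ge>v. y u = (x(v := e)) u" "b + d + (\<Sum>u<v. c u) < F y"
      by (auto simp: less_relax_iff Suc.IH)
    then have "\<forall>u<Suc v. digit_step (y u) (x u) ((c(v := d)) u)" by (auto simp: less_Suc_eq)
    moreover have "(\<Sum>u<v. (c(v := d)) u) = (\<Sum>u<v. c u)" by (intro sum.cong) auto
    ultimately show "\<exists>y c. (\<forall>u<Suc v. digit_step (y u) (x u) (c u)) \<and> (\<forall>u\<ge>Suc v. y u = x u) \<and>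
        b + (\<Sum>u<Suc v. c u) < F y"
      using * by (intro exI[of _ y] exI[of _ "c(v := d)"]) auto
  next
    assume "\<exists>y c. (\<forall>u<Suc v. digit_step (y u) (x u) (c u)) \<and> (\<forall>u\<ge>Suc v. y u = x u) \<and>
        b + (\<Sum>u<Suc v. c u) < F y"
    then obtain y c where *: "\<forall>u<Suc v. digit_step (y u) (x u) (c u)" "\<forall>u\<ge>Suc v. y u = x u"
        "b + (\<Sum>u<Suc v. c u) < F y" by blast
    have "b + c v < relax_upto v F (x(v := y v))"
      unfolding Suc.IH using * by (intro exI[of _ y] exI[of _ c]) (auto simp: Suc_le_eq add_ac)
    with * show "b < relax_upto (Suc v) F x"
      by (auto simp: less_relax_iff)
  qed
qed

text \<open>The offset of one in \<open>budget\<close> makes the left side strict and the right side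
  weak; \<open>b = 0\<close> then expresses plain feasibility.\<close>

lemma less_budget_iff:
  "b < budget n E L t x \<longleftrightarrow>
     (\<exists>p c. is_path n E t p c \<and> p t = x \<and> b + (\<Sum>i<t. \<Sum>u<n. c i u) \<le> L)"
proof (induction t arbitrary: b x)
  case 0
  show ?case by (auto simp: is_path_def less_Suc_eq_le intro: exI[of _ "\<lambda>_ _. 0"])
next
  case (Suc t)
  show ?case
  proof
    assume "b < budget n E L (Suc t) x"
    then obtain y d p c where *: "covers_at n (E (Suc t)) x" "\<forall>u<n. digit_step (y u) (x u) (d u)"
      "\<forall>u\<ge>n. y u = x u" "is_path n E t p c" "p t = y"
      "b + (\<Sum>u<n. d u) + (\<Sum>i<t. \<Sum>u<n. c i u) \<le> L"
      by (auto simp: less_relax_upto_iff Suc.IH split: if_splits)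
    let ?p = "p(Suc t := x)" and ?c = "c(t := d)"
    have "is_path n E (Suc t) ?p ?c"
      using * unfolding is_path_def by (auto simp: less_Suc_eq)
    moreover have "(\<Sum>i<t. \<Sum>u<n. ?c i u) = (\<Sum>i<t. \<Sum>u<n. c i u)"
      by (intro sum.cong) auto
    ultimately show "\<exists>p c. is_path n E (Suc t) p c \<and> p (Suc t) = x \<and>
        b + (\<Sum>i<Suc t. \<Sum>u<n. c i u) \<le> L"
      using *(6) by (intro exI[of _ ?p] exI[of _ ?c]) auto
  next
    assume "\<exists>p c. is_path n E (Suc t) p c \<and> p (Suc t) = x \<and>
        b + (\<Sum>i<Suc t. \<Sum>u<n. c i u) \<le> L"
    then obtain p c where *: "is_path n E (Suc t) p c" "p (Suc t) = x"
        "b + (\<Sum>u<n. c t u) + (\<Sum>i<t. \<Sum>u<n. c i u) \<le> L" by (auto simp: add_ac)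
    then have "is_path n E t p c" by (auto simp: is_path_def)
    with * have "b + (\<Sum>u<n. c t u) < budget n E L t (p t)" unfolding Suc.IH by blast
    with * have "b < relax_upto n (budget n E L t) x"
      unfolding less_relax_upto_iff
      by (intro exI[of _ "p t"] exI[of _ "c t"]) (auto simp: is_path_def)
    with * show "b < budget n E L (Suc t) x" by (auto simp: is_path_def)
  qed
qed

section \<open>Timelines and paths\<close>

lemma sum_mono_strict_at:
  fixes f g :: "'a \<Rightarrow> nat"
  assumes "finite S" "\<And>s. s \<in> S \<Longrightarrow> f s \<le> g s" "z \<in> S" "f z < g z"
  shows "Suc (sum f S) \<le> sum g S"
  using sum_strict_mono_ex1[OF assms(1), of f g] assms(2-4) by (auto simp: Suc_le_eq)

text \<open>A step to \<open>Suc i\<close> continues if a single interval contains both times. An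
  active time that is not reached by continuation is the start of some interval, so every newly
  counted interval is paid for by a start, and every charged step by an interval spanning
  it.\<close>

lemma path_of_intervals:
  fixes S :: "(nat \<times> nat) set"
  assumes fin: "finite S" and pos: "\<And>a b. (a, b) \<in> S \<Longrightarrow> 1 \<le> a \<and> a \<le> b"
  obtains q d where "q 0 = 0" "\<And>i. digit_step (q i) (q (Suc i)) (d i)"
    "\<And>i. odd (q i) \<longleftrightarrow> (\<exists>(a, b)\<in>S. a \<le> i \<and> i \<le> b)"
    "\<And>i. q i \<le> 2 * min (card S) i" "\<And>i. (\<Sum>j<i. d j) \<le> (\<Sum>(a, b)\<in>S. b - a)"
proof -
  define on where "on i \<longleftrightarrow> (\<exists>(a, b)\<in>S. a \<le> i \<and> i \<le> b)" for i
  define cont where "cont i \<longleftrightarrow> (\<exists>(a, b)\<in>S. a \<le> i \<and> Suc i \<le> b)" for i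
  \<comment> \<open>\<open>e + e mod 2\<close> closes an interval that is running, and
    \<open>e + 1 + e mod 2\<close> is the next odd digit whether or not one is running.\<close>
  define q :: "nat \<Rightarrow> nat" where "q = rec_nat 0 (\<lambda>i e. if \<not> on (Suc i) then e + e mod 2
      else if cont i then e else e + 1 + e mod 2)"
  define d where "d i = (if cont i then 1 else 0::nat)" for i
  have q0: "q 0 = 0" by (simp add: q_def)
  have qS: "q (Suc i) = (if \<not> on (Suc i) then q i + q i mod 2
      else if cont i then q i else q i + 1 + q i mod 2)" for i
    by (simp add: q_def)
  have contD: "on i \<and> on (Suc i)" if "cont i" for i
  proof -
    from that obtain a b where "(a, b) \<in> S" "a \<le> i" "Suc i \<le> b" by (auto simp: cont_def)
    then show ?thesis unfolding on_def by (intro conjI bexI[of _ "(a, b)"]) auto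
  qed
  have par: "odd (q i) \<longleftrightarrow> on i" for i
  proof (induction i)
    case 0
    have "\<not> on 0" using pos by (fastforce simp: on_def)
    then show ?case by (simp add: q0)
  next
    case (Suc i)
    show ?case using Suc contD[of i] by (auto simp: qS mod_2_eq_odd)
  qed
  have digit_step: "digit_step (q i) (q (Suc i)) (d i)" for i
    using par[of i] contD[of i] by (auto simp: qS d_def digit_step_def mod_2_eq_odd)
  \<comment> \<open>Intervals starting at the same time are counted once, so the number of starts
    can be capped by \<open>i\<close>; this cap becomes the bound by \<tau>.\<close>
  define m where "m i = min (card {s\<in>S. fst s \<le> i}) i" for i
  have card_le: "card {s\<in>S. fst s \<le> i} \<le> card {s\<in>S. fst s \<le> Suc i}" for i
    using fin by (intro card_mono) auto
  have m_le: "m i \<le> m (Suc i)" for i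
    using card_le[of i] by (auto simp: m_def)
  have m_less: "m i < m (Suc i)" if "on (Suc i)" "\<not> cont i" for i
  proof -
    from that obtain a b where ab: "(a, b) \<in> S" "a \<le> Suc i" "Suc i \<le> b" "\<not> a \<le> i"
      by (auto simp: on_def cont_def)
    then have "insert (a, b) {s\<in>S. fst s \<le> i} \<subseteq> {s\<in>S. fst s \<le> Suc i}"
      "(a, b) \<notin> {s\<in>S. fst s \<le> i}" by auto
    then have "Suc (card {s\<in>S. fst s \<le> i}) \<le> card {s\<in>S. fst s \<le> Suc i}"
      using fin card_mono[of "{s\<in>S. fst s \<le> Suc i}" "insert (a, b) {s\<in>S. fst s \<le> i}"] by auto
    then show ?thesis by (auto simp: m_def)
  qed
  \<comment> \<open>Rounding \<open>q i\<close> up to an even number counts a running interval in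
    full, which is what makes the claim inductive.\<close>
  have cnt: "q i + q i mod 2 \<le> 2 * m i" for i
  proof (induction i)
    case (Suc i)
    show ?case
    proof (cases "on (Suc i) \<and> \<not> cont i")
      case True
      then show ?thesis using Suc m_less[of i] par[of i] by (auto simp: qS mod_2_eq_odd)
    next
      case False
      then show ?thesis using Suc m_le[of i] par[of i] contD[of i] by (auto simp: qS mod_2_eq_odd)
    qed
  qed (simp add: q0)
  \<comment> \<open>All intervals are cut off at time \<open>i\<close>. No term shrinks when
    \<open>i\<close> grows, and in a charged step the interval containing \<open>i\<close> and
    \<open>Suc i\<close> gains one.\<close>
  have cost: "(\<Sum>j<i. d j) \<le> (\<Sum>(a, b)\<in>S. min b i - min a i)" for i
  proof (induction i)
    case (Suc i)
    let ?f = "\<lambda>i (a, b). min b i - min a i"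
    have mono: "?f i s \<le> ?f (Suc i) s" for s by (auto split: prod.splits)
    show ?case
    proof (cases "cont i")
      case True
      then obtain a b where "(a, b) \<in> S" "a \<le> i" "Suc i \<le> b" by (auto simp: cont_def)
      then have "Suc (sum (?f i) S) \<le> sum (?f (Suc i)) S"
        using mono by (intro sum_mono_strict_at[OF fin, of _ _ "(a, b)"]) auto
      then show ?thesis using Suc True by (simp add: d_def)
    next
      case False
      have "sum (?f i) S \<le> sum (?f (Suc i)) S" by (intro sum_mono mono)
      then show ?thesis using Suc False by (simp add: d_def)
    qed
  qed simp
  have "(\<Sum>j<i. d j) \<le> (\<Sum>(a, b)\<in>S. b - a)" for i
    using cost[of i] by (rule order_trans) (intro sum_mono, auto)
  moreover have "q i \<le> 2 * min (card S) i" for i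
  proof -
    have "card {s\<in>S. fst s \<le> i} \<le> card S" using fin by (intro card_mono) auto
    then show ?thesis using cnt[of i] by (auto simp: m_def)
  qed
  ultimately show ?thesis using that q0 digit_step par unfolding on_def by blast
qed

text \<open>The intervals are grown along the path: staying at an odd digit prolongs the interval
  that ends now, and reaching a new odd digit opens a one-point interval of length 0. The factor 2
  and \<open>Suc\<close> match the coding of \<open>c\<close> intervals by \<open>2 * c - 1\<close>
  or \<open>2 * c\<close>.\<close>

lemma intervals_of_path:
  assumes "q 0 = 0" "\<And>i. i < t \<Longrightarrow> digit_step (q i) (q (Suc i)) (d i)"
  shows "\<exists>S. S \<subseteq> {(a, b). 1 \<le> a \<and> a \<le> b \<and> b \<le> t} \<and> 2 * card S \<le> Suc (q t) \<and>
    (\<Sum>(a, b)\<in>S. b - a) \<le> (\<Sum>j<t. d j) \<and>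
    (\<forall>i\<le>t. odd (q i) \<longrightarrow> (\<exists>(a, b)\<in>S. a \<le> i \<and> i \<le> b))"
  using assms
proof (induction t)
  case 0
  then show ?case by (intro exI[of _ "{}"]) auto
next
  case (Suc t)
  have "digit_step (q i) (q (Suc i)) (d i)" if "i < t" for i
    using Suc.prems(2) that by simp
  from Suc.IH[OF Suc.prems(1) this]
  obtain S where S: "S \<subseteq> {(a, b). 1 \<le> a \<and> a \<le> b \<and> b \<le> t}" "2 * card S \<le> Suc (q t)"
    "(\<Sum>(a, b)\<in>S. b - a) \<le> (\<Sum>j<t. d j)"
    "\<forall>i\<le>t. odd (q i) \<longrightarrow> (\<exists>(a, b)\<in>S. a \<le> i \<and> i \<le> b)"
    by blast
  note on_S = S(4)[rule_format]
  have "finite S" using S(1) by (rule finite_subset) (rule finite_subset[of _ "{..t} \<times> {..t}"], auto)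
  consider "odd (q t)" "q (Suc t) = q t" "d t = 1" | "even (q (Suc t))" "q t \<le> q (Suc t)"
    "even (q t) \<longrightarrow> q t = q (Suc t)"
    | "odd (q (Suc t))" "q t < q (Suc t)" "odd (q t) \<longrightarrow> q (Suc t) = q t + 2"
    using Suc.prems(2)[of t] by (cases "even (q t)") (auto simp: digit_step_def mod_2_eq_odd)
  then show ?case
  proof cases
    case 1
    \<comment> \<open>The interval active at \<open>t\<close> must end there, since no interval
      reaches beyond \<open>t\<close>. Replacing its end by \<open>Suc t\<close> keeps the number of
      intervals and adds the length paid for by \<open>d t = 1\<close>.\<close>
    from on_S[OF order_refl 1(1)] obtain a b where ab: "(a, b) \<in> S" "a \<le> t" "t \<le> b" by blast
    moreover from ab(1) S(1) have "1 \<le> a" "b \<le> t" by blast+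
    ultimately have a: "(a, t) \<in> S" "1 \<le> a" "a \<le> t" by auto
    let ?S = "insert (a, Suc t) (S - {(a, t)})"
    have new: "(a, Suc t) \<notin> S" using S(1) by auto
    have "(\<Sum>(a, b)\<in>?S. b - a) = (Suc t - a) + (\<Sum>(a, b)\<in>S - {(a, t)}. b - a)"
      using \<open>finite S\<close> new by simp
    also have "\<dots> = Suc ((t - a) + (\<Sum>(a, b)\<in>S - {(a, t)}. b - a))"
      using a(3) by simp
    also have "(t - a) + (\<Sum>(a, b)\<in>S - {(a, t)}. b - a) = (\<Sum>(a, b)\<in>S. b - a)"
      using sum.remove[OF \<open>finite S\<close> a(1), of "\<lambda>(a, b). b - a"] by simp
    finally have "(\<Sum>(a, b)\<in>?S. b - a) \<le> (\<Sum>j<Suc t. d j)" using S(3) 1(3) by simp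
    moreover have "card ?S = card S"
      using \<open>finite S\<close> new card.remove[OF \<open>finite S\<close> a(1)] by simp
    moreover have "\<exists>(a', b)\<in>?S. a' \<le> i \<and> i \<le> b" if i: "i \<le> Suc t" "odd (q i)" for i
    proof (cases "a \<le> i")
      case False
      then have "i \<le> t" using a by simp
      from on_S[OF this i(2)] obtain a' b' where "(a', b') \<in> S" "a' \<le> i" "i \<le> b'" by auto
      then show ?thesis using False by (intro bexI[of _ "(a', b')"]) auto
    qed (use i in auto)
    moreover have "?S \<subseteq> {(a, b). 1 \<le> a \<and> a \<le> b \<and> b \<le> Suc t}" using S(1) a by auto
    ultimately show ?thesis
      using 1 S(2) by (intro exI[of _ ?S]) simp
  next
    case 2
    have "2 * card S \<le> Suc (q (Suc t))" using S(2) 2(2) by simp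
    moreover have "\<exists>(a, b)\<in>S. a \<le> i \<and> i \<le> b" if i: "i \<le> Suc t" "odd (q i)" for i
      using i 2 on_S[of i] by (auto simp: le_Suc_eq)
    moreover have "S \<subseteq> {(a, b). 1 \<le> a \<and> a \<le> b \<and> b \<le> Suc t}" using S(1) by auto
    ultimately show ?thesis using S(3) by (intro exI[of _ S]) auto
  next
    case 3
    let ?S = "insert (Suc t, Suc t) S"
    have new: "(Suc t, Suc t) \<notin> S" using S(1) by auto
    have "2 * card ?S \<le> Suc (q (Suc t))"
    proof -
      have "2 * card S \<le> Suc (q t)" "2 * card ?S = 2 * card S + 2" using S(2) new \<open>finite S\<close> by auto
      \<comment> \<open>For even \<open>q t\<close>, parity sharpens
        \<open>2 * card S \<le> Suc (q t)\<close> to \<open>2 * card S \<le> q t\<close>, which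
        leaves room for the new interval.\<close>
      then show ?thesis using 3 by presburger
    qed
    moreover have "(\<Sum>(a, b)\<in>?S. b - a) \<le> (\<Sum>j<Suc t. d j)"
      using S(3) new \<open>finite S\<close> by simp
    moreover have "\<exists>(a, b)\<in>?S. a \<le> i \<and> i \<le> b" if i: "i \<le> Suc t" "odd (q i)" for i
      using i on_S[of i] by (auto simp: le_Suc_eq)
    moreover have "?S \<subseteq> {(a, b). 1 \<le> a \<and> a \<le> b \<and> b \<le> Suc t}" using S(1) by auto
    ultimately show ?thesis by (intro exI[of _ ?S]) blast
  qed
qed

text \<open>A timeline is a disjoint union of interval sets, one per vertex, so the conversions for
  a single vertex apply separately and the sums over time and vertices are exchanged. As digits
  never decrease, it suffices to bound the last one; conversely
  \<open>2 * card S \<le> Suc (2 * min k \<tau>)\<close> yields \<open>card S \<le> k\<close> by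
  parity.\<close>

lemma MinTimeline_plus_iff_path:
  assumes G: "temporal_graph {0..<n} \<tau> E"
  shows "MinTimeline_plus {0..<n} \<tau> E k L \<longleftrightarrow>
    (\<exists>p c. is_path n E \<tau> p c \<and> (\<forall>v<n. p \<tau> v \<le> 2 * min k \<tau>) \<and> (\<Sum>i<\<tau>. \<Sum>u<n. c i u) \<le> L)"
proof
  assume "MinTimeline_plus {0..<n} \<tau> E k L"
  then obtain T where T: "activity_timeline k {0..<n} \<tau> T" "covers T \<tau> E"
    "(\<Sum>(v, a, b)\<in>T. b - a) \<le> L" unfolding MinTimeline_plus_def by blast
  define S where "S v = {(a, b). (v, a, b) \<in> T}" for v
  have TS: "T = Sigma {..<n} S" using T(1) by (auto simp: S_def activity_timeline_def)
  have S: "S v \<subseteq> {1..\<tau>} \<times> {1..\<tau>}" for v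
    using T(1) by (auto simp: S_def activity_timeline_def)
  then have fin: "finite (S v)" for v by (rule finite_subset) auto
  define A where "A v q d \<longleftrightarrow> q 0 = 0 \<and> (\<forall>i. digit_step (q i) (q (Suc i)) (d i)) \<and>
    (\<forall>i. odd (q i) \<longleftrightarrow> (\<exists>(a, b)\<in>S v. a \<le> i \<and> i \<le> b)) \<and>
    (\<forall>i. q i \<le> 2 * min (card (S v)) i) \<and> (\<forall>i. (\<Sum>j<i. d j) \<le> (\<Sum>(a, b)\<in>S v. b - a))"
    for v q d
  have "\<exists>q d. A v q d" for v
    unfolding A_def
  proof (rule path_of_intervals[OF fin])
    show "1 \<le> a \<and> a \<le> b" if "(a, b) \<in> S v" for a b
      using that T(1) by (auto simp: S_def activity_timeline_def)
  qed blast
  then obtain q d where "\<And>v. A v (q v) (d v)" by metis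
  then have q: "\<And>v. q v 0 = 0" "\<And>v i. digit_step (q v i) (q v (Suc i)) (d v i)"
    "\<And>v i. odd (q v i) \<longleftrightarrow> (\<exists>(a, b)\<in>S v. a \<le> i \<and> i \<le> b)"
    "\<And>v i. q v i \<le> 2 * min (card (S v)) i" "\<And>v i. (\<Sum>j<i. d v j) \<le> (\<Sum>(a, b)\<in>S v. b - a)"
    unfolding A_def by blast+
  define p where "p i v = (if v < n then q v i else 0)" for i v
  have "is_path n E \<tau> p (\<lambda>i v. d v i)"
    unfolding is_path_def
  proof (intro conjI allI impI)
    fix i assume i: "i < \<tau>"
    show "covers_at n (E (Suc i)) (p (Suc i))"
      unfolding covers_at_def
    proof (intro allI impI, elim conjE)
      fix u v assume uv: "u < v" "v < n" "{u, v} \<in> E (Suc i)"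
      have "\<exists>x\<in>{u, v}. \<exists>a b. (x, a, b) \<in> T \<and> a \<le> Suc i \<and> Suc i \<le> b"
        using T(2)[unfolded covers_def, rule_format, of "Suc i" "{u, v}"] i uv by simp
      then have "odd (q u (Suc i)) \<or> odd (q v (Suc i))"
        unfolding q(3) by (auto simp: S_def)
      then show "odd (p (Suc i) u) \<or> odd (p (Suc i) v)" using uv by (simp add: p_def)
    qed
  qed (auto simp: p_def q(1,2))
  moreover have "card (S v) \<le> k" if "v < n" for v
    using T(1) that by (auto simp: S_def activity_timeline_def)
  then have "p \<tau> v \<le> 2 * min k \<tau>" if "v < n" for v
    using that q(4)[of v \<tau>] by (fastforce simp: p_def)
  moreover have "(\<Sum>i<\<tau>. \<Sum>v<n. d v i) \<le> L"
  proof -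
    have "(\<Sum>i<\<tau>. \<Sum>v<n. d v i) = (\<Sum>v<n. \<Sum>i<\<tau>. d v i)" by (rule sum.swap)
    also have "\<dots> \<le> (\<Sum>v<n. \<Sum>(a, b)\<in>S v. b - a)" by (intro sum_mono q(5))
    also have "\<dots> = (\<Sum>(v, a, b)\<in>T. b - a)" unfolding TS by (subst sum.Sigma) (auto simp: fin)
    finally show ?thesis using T(3) by simp
  qed
  ultimately show "\<exists>p c. is_path n E \<tau> p c \<and> (\<forall>v<n. p \<tau> v \<le> 2 * min k \<tau>) \<and>
      (\<Sum>i<\<tau>. \<Sum>u<n. c i u) \<le> L" by blast
next
  assume "\<exists>p c. is_path n E \<tau> p c \<and> (\<forall>v<n. p \<tau> v \<le> 2 * min k \<tau>) \<and> (\<Sum>i<\<tau>. \<Sum>u<n. c i u) \<le> L"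
  then obtain p c where p: "is_path n E \<tau> p c" "\<forall>v<n. p \<tau> v \<le> 2 * min k \<tau>"
    "(\<Sum>i<\<tau>. \<Sum>u<n. c i u) \<le> L" by blast
  define A where "A v S \<longleftrightarrow> S \<subseteq> {(a, b). 1 \<le> a \<and> a \<le> b \<and> b \<le> \<tau>} \<and> 2 * card S \<le> Suc (p \<tau> v) \<and>
    (\<Sum>(a, b)\<in>S. b - a) \<le> (\<Sum>j<\<tau>. c j v) \<and>
    (\<forall>i\<le>\<tau>. odd (p i v) \<longrightarrow> (\<exists>(a, b)\<in>S. a \<le> i \<and> i \<le> b))" for v S
  have "\<exists>S. A v S" if "v < n" for v
    unfolding A_def using p(1) that by (intro intervals_of_path) (auto simp: is_path_def)
  then obtain S where "\<And>v. v < n \<Longrightarrow> A v (S v)" by metis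
  note A = this[unfolded A_def]
  note S = A[THEN conjunct1] A[THEN conjunct2, THEN conjunct1]
    A[THEN conjunct2, THEN conjunct2, THEN conjunct1]
  note S4 = A[THEN conjunct2, THEN conjunct2, THEN conjunct2, rule_format]
  define T where "T = Sigma {..<n} S"
  have fin: "finite (S v)" if "v < n" for v
    using S(1)[OF that] by (rule finite_subset) (rule finite_subset[of _ "{..\<tau>} \<times> {..\<tau>}"], auto)
  have "card (S v) \<le> k" if "v < n" for v
    using S(2)[OF that] p(2)[rule_format, OF that] by simp
  moreover have "{(a, b). (v, a, b) \<in> T} = S v" if "v < n" for v using that by (auto simp: T_def)
  moreover have "T \<subseteq> {(v, a, b). v \<in> {0..<n} \<and> a \<in> {1..\<tau>} \<and> b \<in> {1..\<tau>} \<and> a \<le> b}"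
  proof
    fix x assume "x \<in> T"
    then obtain v a b where "x = (v, a, b)" "v < n" "(a, b) \<in> S v" by (auto simp: T_def)
    then show "x \<in> {(v, a, b). v \<in> {0..<n} \<and> a \<in> {1..\<tau>} \<and> b \<in> {1..\<tau>} \<and> a \<le> b}"
      using S(1)[of v] by auto
  qed
  ultimately have "activity_timeline k {0..<n} \<tau> T"
    by (simp add: activity_timeline_def)
  moreover have "covers T \<tau> E"
    unfolding covers_def
  proof (intro ballI)
    fix t e assume t: "t \<in> {1..\<tau>}" and e: "e \<in> E t"
    then have "e \<subseteq> {0..<n}" "card e = 2" using G by (auto simp: temporal_graph_def)
    then obtain x y where "e = {x, y}" "x \<noteq> y" "x < n" "y < n"
      unfolding card_2_iff by (elim exE conjE) simp
    then obtain u v where uv: "e = {u, v}" "u < v" "v < n"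
      by (metis insert_commute linorder_neqE_nat)
    obtain i where i: "t = Suc i" "i < \<tau>" using t by (cases t) auto
    have "covers_at n (E t) (p t)" using p(1) i by (auto simp: is_path_def)
    then obtain w where w: "w \<in> e" "odd (p t w)"
      using uv e unfolding covers_at_def by blast
    then have "w < n" using uv by auto
    from S4[OF this _ w(2)] t obtain a b where "(a, b) \<in> S w" "a \<le> t" "t \<le> b" by auto
    then show "\<exists>x\<in>e. \<exists>a b. (x, a, b) \<in> T \<and> a \<le> t \<and> t \<le> b"
      using w \<open>w < n\<close> by (intro bexI[of _ w] exI[of _ a] exI[of _ b]) (auto simp: T_def)
  qed
  moreover have "(\<Sum>(v, a, b)\<in>T. b - a) \<le> L"
  proof -
    have "(\<Sum>(v, a, b)\<in>T. b - a) = (\<Sum>v<n. \<Sum>(a, b)\<in>S v. b - a)"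
      unfolding T_def by (subst sum.Sigma) (auto simp: fin)
    also have "\<dots> \<le> (\<Sum>v<n. \<Sum>i<\<tau>. c i v)" by (intro sum_mono S(3)) auto
    also have "\<dots> = (\<Sum>i<\<tau>. \<Sum>v<n. c i v)" by (rule sum.swap)
    finally show ?thesis using p(3) by simp
  qed
  ultimately show "MinTimeline_plus {0..<n} \<tau> E k L" unfolding MinTimeline_plus_def by blast
qed

text \<open>Frozen coordinates stay 0, so the end of a path is one of finitely many states, and the
  question becomes whether a finite table has a nonzero entry.\<close>

lemma MinTimeline_plus_iff_budget:
  assumes G: "temporal_graph {0..<n} \<tau> E"
  shows "MinTimeline_plus {0..<n} \<tau> E k L \<longleftrightarrow>
    (\<exists>x. (\<forall>v<n. x v \<le> 2 * min k \<tau>) \<and> (\<forall>v\<ge>n. x v = 0) \<and> budget n E L \<tau> x \<noteq> 0)"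
proof -
  have outside: "p \<tau> v = 0" if "is_path n E \<tau> p c" "n \<le> v" for p c v
  proof -
    have "i \<le> \<tau> \<Longrightarrow> p i v = 0" for i
    proof (induction i)
      case (Suc i)
      then have "p i v = p (Suc i) v" using that by (simp add: is_path_def)
      with Suc show ?case by simp
    qed (use that in \<open>simp add: is_path_def\<close>)
    then show ?thesis by simp
  qed
  have budget: "budget n E L \<tau> x \<noteq> 0 \<longleftrightarrow> (\<exists>p c. is_path n E \<tau> p c \<and> p \<tau> = x \<and>
      (\<Sum>i<\<tau>. \<Sum>u<n. c i u) \<le> L)" for x
    unfolding neq0_conv less_budget_iff by (simp only: add_0)
  show ?thesis
    unfolding MinTimeline_plus_iff_path[OF G] budget
  proof (intro iffI; elim exE conjE)
    fix p c
    assume p: "is_path n E \<tau> p c" "\<forall>v<n. p \<tau> v \<le> 2 * min k \<tau>" "(\<Sum>i<\<tau>. \<Sum>u<n. c i u) \<le> L"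
    show "\<exists>x. (\<forall>v<n. x v \<le> 2 * min k \<tau>) \<and> (\<forall>v\<ge>n. x v = 0) \<and>
        (\<exists>p c. is_path n E \<tau> p c \<and> p \<tau> = x \<and> (\<Sum>i<\<tau>. \<Sum>u<n. c i u) \<le> L)"
      using p outside[OF p(1)] by (intro exI[of _ "p \<tau>"] conjI exI[of _ p] exI[of _ c]) auto
  next
    fix x p c
    assume "is_path n E \<tau> p c" "p \<tau> = x" "\<forall>v<n. x v \<le> 2 * min k \<tau>" "(\<Sum>i<\<tau>. \<Sum>u<n. c i u) \<le> L"
    then show "\<exists>p c. is_path n E \<tau> p c \<and> (\<forall>v<n. p \<tau> v \<le> 2 * min k \<tau>) \<and> (\<Sum>i<\<tau>. \<Sum>u<n. c i u) \<le> L"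
      by (intro exI[of _ p] exI[of _ c]) simp
  qed
qed

section \<open>Verification conditions for loop-free code, and program rules with slack in the time
  bound\<close>

lemma wp_Seq_le: "wp c S (wp d T Q) r h \<Longrightarrow> S + T \<le> U \<Longrightarrow> wp (c ;; d) U Q r h"
  by (rule wp_mono[OF wp_Seq]) auto

text \<open>\<open>vc\<close> rejects loops, so the value of \<open>max_steps\<close> on them is irrelevant.\<close>

fun vc where
  "vc (Blk xs) Q r h \<longleftrightarrow> blk xs Q r h"
| "vc (c ;; d) Q r h \<longleftrightarrow> vc c (vc d Q) r h"
| "vc (If x c d) Q r h \<longleftrightarrow>
     x < 64 \<and> (if r x \<noteq> 0 then vc c (\<lambda>r. Q (r(63 := 0))) r h else vc d Q r h)"
| "vc (While xs x c) Q r h \<longleftrightarrow> False"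

fun max_steps :: "com \<Rightarrow> nat" where
  "max_steps (Blk xs) = length xs"
| "max_steps (c ;; d) = max_steps c + max_steps d"
| "max_steps (If x c d) = max_steps c + max_steps d + 3"
| "max_steps (While xs x c) = 0"

lemma wp_vc: "vc c Q r h \<Longrightarrow> wp c (max_steps c) Q r h"
proof (induction c arbitrary: Q r h)
  case (Blk xs)
  then show ?case by (simp add: wp_Blk)
next
  case (Seq c d)
  then have "wp c (max_steps c) (vc d Q) r h" by simp
  then have "wp c (max_steps c) (wp d (max_steps d) Q) r h" by (rule wp_mono) (auto intro: Seq)
  then show ?case by (simp add: wp_Seq)
next
  case (If x c d)
  then show ?case by (auto intro!: wp_If simp del: fun_upd_apply split: if_splits)
qed simp

lemma wp_vc_le: "vc c Q r h \<Longrightarrow> max_steps c \<le> T \<Longrightarrow> wp c T Q r h"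
  by (rule wp_mono[OF wp_vc])

lemma wp_vc_Seq: "vc c (wp d T Q) r h \<Longrightarrow> max_steps c + T \<le> U \<Longrightarrow> wp (c ;; d) U Q r h"
  by (rule wp_Seq_le[OF wp_vc])

lemma wp_While_le:
  assumes "I N r h"
    and "\<And>i r h. I i r h \<Longrightarrow> i \<le> N \<Longrightarrow> blk xs (\<lambda>r h.
      if r x = 0 then Q r h else 0 < i \<and> wp c T (\<lambda>r h. \<exists>j<i. I j (r(63 := 0)) h) r h) r h"
    and "x < 64" "N * (T + length xs + 3) + length xs + 1 \<le> U"
  shows "wp (While xs x c) U Q r h"
  by (rule wp_mono[OF wp_While[of I N r h xs x Q c T]]) (use assms in auto)

section \<open>Numbering the states\<close>

text \<open>Numerals in base \<open>Suc d\<close> with vertex 0 least significant: lowering the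
  digit of \<open>v\<close> by one lowers the table address by \<open>Suc d ^ v\<close>.\<close>

definition state_index :: "nat \<Rightarrow> nat \<Rightarrow> (nat \<Rightarrow> nat) \<Rightarrow> nat" where
  "state_index d n x = (\<Sum>v<n. x v * Suc d ^ v)"

definition valid :: "nat \<Rightarrow> nat \<Rightarrow> (nat \<Rightarrow> nat) \<Rightarrow> bool" where
  "valid d n x \<longleftrightarrow> (\<forall>v<n. x v \<le> d) \<and> (\<forall>v\<ge>n. x v = 0)"

lemma state_index_less:
  assumes "\<forall>v<n. x v \<le> d"
  shows "state_index d n x < Suc d ^ n"
  using assms
proof (induction n)
  case (Suc n)
  then have "state_index d n x < Suc d ^ n" by simp
  moreover have "x n * Suc d ^ n \<le> d * Suc d ^ n" using Suc by (intro mult_right_mono) auto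
  moreover have "state_index d (Suc n) x = state_index d n x + x n * Suc d ^ n" by (simp add: state_index_def)
  moreover have "Suc d ^ Suc n = Suc d ^ n + d * Suc d ^ n" by simp
  ultimately show ?case by linarith
qed (simp add: state_index_def)

lemma state_index_inj:
  assumes "valid d n x" "valid d n y" "state_index d n x = state_index d n y"
  shows "x = y"
proof -
  have "\<forall>v<m. x v = y v" if "m \<le> n" "state_index d m x = state_index d m y" for m
    using that
  proof (induction m)
    case (Suc m)
    have less: "state_index d m x < Suc d ^ m" "state_index d m y < Suc d ^ m"
      using assms Suc.prems by (auto intro!: state_index_less simp: valid_def)
    have eq: "state_index d m x + x m * Suc d ^ m = state_index d m y + y m * Suc d ^ m"
      using Suc.prems by (simp add: state_index_def)
    have "x m = (state_index d m x + x m * Suc d ^ m) div Suc d ^ m" using less by simp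
    also have "\<dots> = y m" unfolding eq using less by simp
    finally show ?case using Suc eq by (auto simp: less_Suc_eq)
  qed simp
  with assms have "x v = y v" for v by (cases "v < n") (auto simp: valid_def)
  then show ?thesis by auto
qed

lemma state_index_surj:
  assumes "s < Suc d ^ n"
  obtains x where "valid d n x" "state_index d n x = s"
proof -
  have "\<exists>x. valid d n x \<and> state_index d n x = s"
    using assms
  proof (induction n arbitrary: s)
    case 0
    then show ?case by (auto simp: valid_def state_index_def)
  next
    case (Suc n)
    obtain x where x: "valid d n x" "state_index d n x = s mod Suc d ^ n"
      using Suc.IH[of "s mod Suc d ^ n"] by auto
    have "s div Suc d ^ n < Suc d" using Suc.prems by (simp add: less_mult_imp_div_less)
    with x have "valid d (Suc n) (x(n := s div Suc d ^ n))"
      by (auto simp: valid_def less_Suc_eq)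
    moreover have "state_index d n (x(n := s div Suc d ^ n)) = state_index d n x"
      unfolding state_index_def by (intro sum.cong) auto
    then have "state_index d (Suc n) (x(n := s div Suc d ^ n)) = s mod Suc d ^ n + s div Suc d ^ n * Suc d ^ n"
      using x(2) by (simp add: state_index_def)
    then have "state_index d (Suc n) (x(n := s div Suc d ^ n)) = s"
      by (simp only: mod_div_mult_eq)
    ultimately show ?case by blast
  qed
  then show ?thesis using that by blast
qed

lemma state_index_upd:
  assumes "v < n"
  shows "state_index d n (x(v := y)) + x v * Suc d ^ v = state_index d n x + y * Suc d ^ v"
proof -
  have "(\<Sum>u\<in>{..<n} - {v}. (x(v := y)) u * Suc d ^ u) = (\<Sum>u\<in>{..<n} - {v}. x u * Suc d ^ u)"
    by (intro sum.cong) auto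
  then show ?thesis using assms unfolding state_index_def by (simp add: sum.remove[of "{..<n}" v])
qed

lemma mod2_pred: "0 < m \<Longrightarrow> (m - 1) mod 2 = 1 - m mod (2::nat)"
  by (cases m) (auto simp: mod_Suc)

lemma valid_upd: "valid d n x \<Longrightarrow> v < n \<Longrightarrow> y \<le> d \<Longrightarrow> valid d n (x(v := y))"
  by (auto simp: valid_def)

lemma state_index_decr:
  assumes "v < n" "k \<le> x v"
  shows "state_index d n (x(v := x v - k)) + k * Suc d ^ v = state_index d n x"
proof -
  have "state_index d n (x(v := x v - k)) + (k + (x v - k)) * Suc d ^ v = state_index d n x + (x v - k) * Suc d ^ v"
    using state_index_upd[OF assms(1), of d x "x v - k"] assms(2) by simp
  then show ?thesis by (simp only: add_mult_distrib)
qed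

section \<open>Sweeping the table\<close>

text \<open>Register conventions: 0 holds \<open>n\<close>, 1 holds \<open>\<tau>\<close>, 2 the largest digit \<open>d = 2 * min k \<tau>\<close>, 3 holds
  \<open>L + 1\<close>, 5 the constant 1, 6 to 9 the base addresses of the input bits, the digits of the current
  state, their parities and the table, 10 the table size \<open>Suc d ^ n\<close>, 11 the number of bits per
  snapshot. Registers 12 and 13 belong to the loop over time (snapshot pointer, remaining steps),
  14 and 15 to the loop over the vertices (\<open>Suc d ^ v\<close> and \<open>v\<close>), 16 to the loop over the states;
  everything from 20 on is scratch.

  The odometer decrements the current state. From state 0 it wraps around to the largest state, so
  that it is ready for the next sweep.\<close>

definition odometer :: com where
  "odometer =
     Blk [LoadConst 20 0, LoadConst 21 1] ;;
     While [] 21 (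
       Blk [Add 22 7 20, LoadInd 23 22] ;;
       If 23
         (Blk [Sub 23 23 5, StoreInd 22 23, Add 22 8 20, LoadInd 23 22, Sub 23 5 23,
               StoreInd 22 23, LoadConst 21 0])
         (Blk [StoreInd 22 2, Add 20 20 5, Sub 21 0 20]))"

text \<open>The counter in register 16 is decremented before the body runs, so there it equals the
  index of the state shown by the odometer.\<close>

definition sweep :: "com \<Rightarrow> com" where
  "sweep c =
     Blk [LoadConst 16 0, Add 16 16 10] ;;
     While [] 16 (Blk [Sub 16 16 5] ;; c ;; odometer)"

text \<open>Since \<open>relax v F x\<close> depends only on states with index at most that of \<open>x\<close>, a descending sweep may
  overwrite the table in place. With truncated subtraction, \<open>a - b + b\<close> is the maximum.\<close>

definition relax_body :: com where
  "relax_body =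
     Blk [Add 20 9 16, LoadInd 21 20, Add 22 7 15, LoadInd 23 22, Add 22 8 15, LoadInd 24 22,
          Sub 21 21 24] ;;
     If 23
       (Blk [Sub 22 20 14, LoadInd 25 22, Sub 21 21 25, Add 21 21 25, Sub 23 23 5] ;;
        If 24
          (If 23 (Blk [Sub 22 22 14, LoadInd 25 22, Sub 21 21 25, Add 21 21 25]) (Blk []))
          (Blk []))
       (Blk []) ;;
     Blk [StoreInd 20 21]"

text \<open>Adding register 14 to a copy of itself \<open>d\<close> times multiplies it by
  \<open>Suc d\<close>, which moves the weight on to the next vertex.\<close>

definition mult_step :: com where
  "mult_step =
     Blk [LoadConst 20 0, Add 20 20 14, LoadConst 21 0, Add 21 21 2] ;;
     While [] 21 (Blk [Add 20 20 14, Sub 21 21 5]) ;;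
     Blk [LoadConst 14 0, Add 14 14 20]"

lemma wp_mult_step:
  assumes r: "r 5 = 1" "r 2 = d"
  shows "wp mult_step (d * 5 + 7) (\<lambda>r' h'. h' = h \<and> r' 14 = r 14 * Suc d \<and> keep 14 r r' \<and>
    (\<forall>i. 14 < i \<and> i < 20 \<longrightarrow> r' i = r i)) r h"
proof -
  let ?I = "\<lambda>i r' h'. h' = h \<and> r' 21 = i \<and> i \<le> d \<and> r' 20 = r 14 * Suc (d - i) \<and> r' 14 = r 14 \<and>
    keep 20 r r'"
  have loop: "wp (While [] 21 (Blk [Add 20 20 14, Sub 21 21 5])) (d * 5 + 1) (?I 0) r1 h1"
    if "?I d r1 h1" for r1 h1
  proof (rule wp_While_le[where I="?I" and N=d and T=2])
    fix i r1 h1 assume I: "?I i r1 h1"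
    then have "r1 5 = 1" using r by (simp add: keep_def)
    then show "blk [] (\<lambda>r h. if r 21 = 0 then ?I 0 r h else 0 < i \<and>
        wp (Blk [Add 20 20 14, Sub 21 21 5]) 2 (\<lambda>r h. \<exists>j<i. ?I j (r(63 := 0)) h) r h) r1 h1"
      using I by (auto intro!: wp_vc_le exI[of _ "i - 1"] simp: Suc_diff_le)
  qed (use that in auto)
  show ?thesis
    unfolding mult_step_def
    apply (rule wp_vc_Seq[where T="d * 5 + 3"])
     apply (simp)
     apply (rule wp_Seq_le[OF wp_mono[OF loop order_refl]])
    using r apply (auto intro!: wp_vc_le simp: keep_def)
    done
qed

text \<open>Evenness of \<open>d\<close> makes the parity of the largest digit 0. When the odometer
  resets a digit from 0 to \<open>d\<close>, the parity cell is already correct, and at the start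
  zero memory is the right parity array.\<close>

locale layout =
  fixes n \<tau> d M bB bD bQ bA :: nat
  assumes n: "2 \<le> n" and d: "even d"
    and base: "64 \<le> bD" "bD + n \<le> bQ" "bQ + n \<le> bA"
begin

definition static :: "(nat \<Rightarrow> nat) \<Rightarrow> bool" where
  "static r \<longleftrightarrow> r 0 = n \<and> r 1 = \<tau> \<and> r 2 = d \<and> r 5 = 1 \<and> r 6 = bB \<and> r 7 = bD \<and> r 8 = bQ \<and>
     r 9 = bA \<and> r 10 = Suc d ^ n \<and> r 11 = M"

definition digits :: "(nat \<Rightarrow> nat) \<Rightarrow> (nat \<Rightarrow> nat) \<Rightarrow> bool" where
  "digits h x \<longleftrightarrow> (\<forall>v<n. h (bD + v) = x v \<and> h (bQ + v) = x v mod 2)"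

lemma static_keep: "static r \<Longrightarrow> keep k r r' \<Longrightarrow> 12 \<le> k \<Longrightarrow> static r'"
  by (simp add: static_def keep_def)

lemma wp_odometer:
  assumes r: "static r" and x: "digits h x" "valid d n x"
  shows "wp odometer (n * 18 + 3) (\<lambda>r' h'. keep 20 r r' \<and> (\<forall>a. a < bD \<or> bA \<le> a \<longrightarrow> h' a = h a) \<and>
    (\<exists>x'. digits h' x' \<and> valid d n x' \<and>
      (Suc (state_index d n x') = state_index d n x \<or> state_index d n x = 0 \<and> Suc (state_index d n x') = Suc d ^ n))) r h"
proof -
  define Q where "Q r' h' \<longleftrightarrow> keep 20 r r' \<and> (\<forall>a. a < bD \<or> bA \<le> a \<longrightarrow> h' a = h a) \<and>
    (\<exists>x'. digits h' x' \<and> valid d n x' \<and>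
      (Suc (state_index d n x') = state_index d n x \<or> state_index d n x = 0 \<and> Suc (state_index d n x') = Suc d ^ n))" for r' h'
  \<comment> \<open>Resetting the lowest \<open>j\<close> digits from 0 to \<open>d\<close> adds
    \<open>Suc d ^ j - 1\<close> to the index; \<open>j\<close> is in register 20. Register 21
    becomes 0 either after a successful decrement or when all positions have been reset.\<close>
  define I where "I i r' h' \<longleftrightarrow> keep 20 r r' \<and> (\<forall>a. a < bD \<or> bA \<le> a \<longrightarrow> h' a = h a) \<and>
    (if r' 21 = 0 then Q r' h' else i = n - r' 20 \<and> r' 20 < n \<and>
      (\<exists>x'. digits h' x' \<and> valid d n x' \<and> Suc (state_index d n x') = state_index d n x + Suc d ^ r' 20))" for i r' h'
  let ?body = "Blk [Add 22 7 20, LoadInd 23 22] ;;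
       If 23
         (Blk [Sub 23 23 5, StoreInd 22 23, Add 22 8 20, LoadInd 23 22, Sub 23 5 23,
               StoreInd 22 23, LoadConst 21 0])
         (Blk [StoreInd 22 2, Add 20 20 5, Sub 21 0 20])"
  have step: "0 < i \<and> wp ?body 15 (\<lambda>r h. \<exists>j<i. I j (r(63 := 0)) h) r1 h1"
    if I: "I i r1 h1" and nz: "r1 21 \<noteq> 0" for i r1 h1
  proof -
    define j where "j = r1 20"
    from I nz have i: "i = n - j" "j < n" "0 < i" and k: "keep 20 r r1"
      and frame: "\<And>a. a < bD \<or> bA \<le> a \<Longrightarrow> h1 a = h a" by (auto simp: I_def j_def)
    from I nz obtain y where y: "digits h1 y" "valid d n y"
      "Suc (state_index d n y) = state_index d n x + Suc d ^ j" by (auto simp: I_def j_def)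
    have r1: "r1 0 = n" "r1 2 = d" "r1 5 = 1" "r1 7 = bD" "r1 8 = bQ" "r1 20 = j"
      using static_keep[OF r k] by (simp_all add: static_def j_def)
    have hj: "h1 (bD + j) = y j" "h1 (bQ + j) = y j mod 2"
      using y(1) i by (auto simp: digits_def)
    have yd: "y j \<le> d" using y(2) i by (simp add: valid_def)
    have "wp ?body 15 (\<lambda>r h. \<exists>j<i. I j (r(63 := 0)) h) r1 h1"
    proof (cases "y j = 0")
      case False
      let ?y = "y(j := y j - 1)"
      let ?h = "h1(bD + j := y j - 1, bQ + j := 1 - y j mod 2)"
      have "digits ?h ?y"
        using y(1) i(2) base mod2_pred[of "y j"] False unfolding digits_def by auto
      moreover have "valid d n ?y" using y(2) i yd by (intro valid_upd) auto
      moreover have "Suc (state_index d n ?y) = state_index d n x"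
        using state_index_decr[of j n 1 y d] y(3) i False by simp
      moreover have "\<forall>a. a < bD \<or> bA \<le> a \<longrightarrow> ?h a = h a" using frame i base by auto
      ultimately have I: "\<exists>j<i. I j r' h'" if "keep 20 r r'" "r' 21 = 0" "h' = ?h" for r' h'
        using that i by (intro exI[of _ 0]) (auto simp: I_def Q_def)
      show ?thesis
        by (rule wp_vc_le) (use r1 k hj False base i(2) in \<open>auto intro!: I\<close>)
    next
      case True
      let ?y = "y(j := d)"
      let ?h = "h1(bD + j := d)"
      have dig: "digits ?h ?y" using y(1) i(2) base True d unfolding digits_def by auto
      have val: "valid d n ?y" using y(2) i yd by (intro valid_upd) auto
      have eq: "Suc (state_index d n ?y) = state_index d n x + Suc d ^ Suc j"
        using state_index_upd[of j n d y d] y(3) i True by simp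
      have fr: "\<forall>a. a < bD \<or> bA \<le> a \<longrightarrow> ?h a = h a" using frame i base by auto
      have I: "\<exists>j<i. I j r' h'"
        if r': "keep 20 r r'" "r' 20 = Suc j" "r' 21 = n - Suc j" "h' = ?h" for r' h'
      proof (cases "Suc j = n")
        case True
        \<comment> \<open>After the last position the equation for the index and this bound leave
          only the state 0 as the initial one: the odometer has wrapped around.\<close>
        have "state_index d n ?y < Suc d ^ n" using val by (intro state_index_less) (simp add: valid_def)
        with eq have "state_index d n x = 0" "Suc (state_index d n ?y) = Suc d ^ n" unfolding True by linarith+
        then have "Q r' h'" using dig val fr r' by (auto simp: Q_def)
        then show ?thesis using i r' fr True by (intro exI[of _ 0]) (simp add: I_def)
      next
        case False
        then have "I (n - Suc j) r' h'"
          using i r' fr dig val eq by (auto simp: I_def simp del: power_Suc)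
        then show ?thesis using i by (intro exI[of _ "n - Suc j"]) auto
      qed
      show ?thesis
        by (rule wp_vc_le) (use r1 k hj True base i(2) in \<open>auto intro!: I\<close>)
    qed
    then show ?thesis using i by simp
  qed
  have loop: "wp (While [] 21 ?body) (n * 18 + 1) Q r1 h1" if "I n r1 h1" for r1 h1
  proof (rule wp_While_le[where I=I and N=n and T=15])
    fix i r1 h1 assume "I i r1 h1"
    then show "blk [] (\<lambda>r h. if r 21 = 0 then Q r h else
        0 < i \<and> wp ?body 15 (\<lambda>r h. \<exists>j<i. I j (r(63 := 0)) h) r h) r1 h1"
      using step[of i r1 h1] by (auto simp: I_def)
  qed (use that in auto)
  have "I n r' h" if "keep 20 r r'" "r' 20 = 0" "r' 21 = 1" for r'
    using that x n by (auto simp: I_def)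
  then show ?thesis
    unfolding odometer_def Q_def[symmetric]
    by (intro wp_vc_Seq[where T="n * 18 + 1"]) (auto intro!: wp_mono[OF loop])
qed

end

section \<open>Testing whether the active vertices cover a snapshot\<close>

definition cover_body :: com where
  "cover_body =
     Blk [LoadConst 20 0, LoadConst 21 0, Add 21 21 12, LoadConst 22 0] ;;
     While [Sub 30 0 22] 30 (
       Blk [Add 24 8 22, LoadInd 24 24, Add 23 22 5] ;;
       While [Sub 30 0 23] 30 (
         Blk [LoadInd 25 21, Add 21 21 5] ;;
         If 25
           (Blk [Add 26 8 23, LoadInd 26 26, Add 26 26 24] ;;
            If 26 (Blk []) (Blk [LoadConst 20 1]))
           (Blk []) ;;
         Blk [Add 23 23 5]) ;;
       Blk [Add 22 22 5]) ;;
     If 20 (Blk [Add 26 9 16, LoadConst 27 0, StoreInd 26 27]) (Blk [])"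

text \<open>Offset of row \<open>u\<close> in the strict upper triangle of the adjacency matrix,
  stored row by row; \<open>row_start n n\<close> is the number of bits of a snapshot.\<close>

definition row_start :: "nat \<Rightarrow> nat \<Rightarrow> nat" where
  "row_start n u = (\<Sum>i<u. n - Suc i)"

context layout
begin

text \<open>Only states with digits up to \<open>d\<close> are stored. This is consistent because
  the predecessors of a state have no larger digits.\<close>

definition table :: "(nat \<Rightarrow> nat) \<Rightarrow> ((nat \<Rightarrow> nat) \<Rightarrow> nat) \<Rightarrow> bool" where
  "table h F \<longleftrightarrow> (\<forall>y. valid d n y \<longrightarrow> h (bA + state_index d n y) = F y)"

definition full :: "(nat \<Rightarrow> nat) \<Rightarrow> bool" where
  "full h \<longleftrightarrow> (\<exists>x. valid d n x \<and> digits h x \<and> Suc (state_index d n x) = Suc d ^ n)"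

text \<open>The body meets a table that already holds \<open>F'\<close> above the current index and
  still holds \<open>F\<close> at and below it, and must promise a single write. Cells below
  \<open>bD\<close> survive, so the snapshots stay intact.\<close>

lemma wp_sweep:
  assumes r: "static r" and h: "full h" "table h F"
    and body: "\<And>r' h' x. keep 16 r r' \<Longrightarrow> \<forall>a<bD. h' a = h a \<Longrightarrow> digits h' x \<Longrightarrow> valid d n x \<Longrightarrow>
      r' 16 = state_index d n x \<Longrightarrow>
      table h' (\<lambda>y. if state_index d n y \<le> state_index d n x then F y else F' y) \<Longrightarrow>
      wp c T (\<lambda>r'' h''. keep 17 r' r'' \<and> h'' = h'(bA + state_index d n x := F' x)) r' h'"
  shows "wp (sweep c) (Suc d ^ n * (T + n * 18 + 7) + 3) (\<lambda>r' h'. keep 16 r r' \<and>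
    (\<forall>a<bD. h' a = h a) \<and> full h' \<and> table h' F') r h"
proof -
  define I where "I i r' h' \<longleftrightarrow> r' 16 = i \<and> keep 16 r r' \<and> (\<forall>a<bD. h' a = h a) \<and>
    (\<exists>x. valid d n x \<and> digits h' x \<and> (Suc (state_index d n x) = i \<or> i = 0 \<and> Suc (state_index d n x) = Suc d ^ n)) \<and>
    table h' (\<lambda>y. if state_index d n y < i then F y else F' y)" for i r' h'
  have step: "wp (Blk [Sub 16 16 5] ;; c ;; odometer) (T + n * 18 + 4)
      (\<lambda>r h. \<exists>j<i. I j (r(63 := 0)) h) r1 h1"
    if I: "I i r1 h1" and i: "0 < i" for i r1 h1
  proof -
    from I i obtain x where k: "keep 16 r r1" and frame: "\<forall>a<bD. h1 a = h a"
      and x: "valid d n x" "digits h1 x" "Suc (state_index d n x) = i" and r16: "r1 16 = i"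
      and tab: "table h1 (\<lambda>y. if state_index d n y < i then F y else F' y)"
      by (auto simp: I_def)
    let ?r = "r1(16 := state_index d n x)"
    let ?h = "h1(bA + state_index d n x := F' x)"
    have r5: "r1 5 = 1" using static_keep[OF r k] by (simp add: static_def)
    have k': "keep 16 r ?r" using k by simp
    have tab': "table ?h (\<lambda>y. if state_index d n y < state_index d n x then F y else F' y)"
      unfolding table_def
    proof (intro allI impI)
      fix y assume y: "valid d n y"
      show "?h (bA + state_index d n y) = (if state_index d n y < state_index d n x then F y else F' y)"
        using tab y x state_index_inj[OF y x(1)] by (auto simp: table_def less_Suc_eq)
    qed
    have dig': "digits ?h x" using x(2) base by (auto simp: digits_def)
    have odo: "wp odometer (n * 18 + 3) (\<lambda>r h. \<exists>j<i. I j (r(63 := 0)) h) r2 ?h"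
      if k2: "keep 17 ?r r2" for r2
    proof -
      have k2': "keep 16 r r2" by (rule keep_trans[OF k' k2]) simp
      have r2: "static r2" using static_keep[OF r k2'] by simp
      show ?thesis
      proof (rule wp_mono[OF wp_odometer[OF r2 dig' x(1)] order_refl], elim conjE)
        fix r3 h3
        assume k3: "keep 20 r2 r3" and fr: "\<forall>a. a < bD \<or> bA \<le> a \<longrightarrow> h3 a = ?h a"
          and ex: "\<exists>x'. digits h3 x' \<and> valid d n x' \<and>
           (Suc (state_index d n x') = state_index d n x \<or> state_index d n x = 0 \<and> Suc (state_index d n x') = Suc d ^ n)"
        have "keep 16 r r3" by (rule keep_trans[OF k2' k3]) simp
        moreover have "r3 16 = state_index d n x" using k2 k3 by (simp add: keep_def)
        moreover have "\<forall>a<bD. h3 a = h a" using fr frame base by auto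
        moreover have "table h3 (\<lambda>y. if state_index d n y < state_index d n x then F y else F' y)"
          using tab' fr by (simp add: table_def)
        ultimately have "I (state_index d n x) (r3(63 := 0)) h3" using ex by (auto simp: I_def)
        then show "\<exists>j<i. I j (r3(63 := 0)) h3" using x(3) by auto
      qed
    qed
    have mid: "wp c T (wp odometer (n * 18 + 3) (\<lambda>r h. \<exists>j<i. I j (r(63 := 0)) h)) ?r h1"
    proof (rule wp_mono[OF body[OF k' frame x(2,1)] order_refl])
      show "table h1 (\<lambda>y. if state_index d n y \<le> state_index d n x then F y else F' y)"
        using tab x(3) by (auto simp: table_def less_Suc_eq_le)
    qed (use odo in auto)
    have eq: "i - Suc 0 = state_index d n x" using x(3) by simp
    show ?thesis
      by (rule wp_vc_Seq[where T="T + (n * 18 + 3)"], simp add: r5 r16 eq, rule wp_Seq[OF mid]) simp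
  qed
  let ?Q = "\<lambda>r' h'. keep 16 r r' \<and> (\<forall>a<bD. h' a = h a) \<and> full h' \<and> table h' F'"
  have loop: "wp (While [] 16 (Blk [Sub 16 16 5] ;; c ;; odometer))
      (Suc d ^ n * (T + n * 18 + 7) + 1) ?Q r1 h1" if "I (Suc d ^ n) r1 h1" for r1 h1
  proof (rule wp_While_le[where I=I and N="Suc d ^ n" and T="T + n * 18 + 4"])
    fix i r1 h1 assume *: "I i r1 h1"
    then have "?Q r1 h1" if "r1 16 = 0" using that by (auto simp: I_def full_def)
    moreover have "r1 16 = i" using * by (simp add: I_def)
    ultimately show "blk [] (\<lambda>r h. if r 16 = 0 then ?Q r h else 0 < i \<and>
        wp (Blk [Sub 16 16 5] ;; c ;; odometer) (T + n * 18 + 4)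
          (\<lambda>r h. \<exists>j<i. I j (r(63 := 0)) h) r h) r1 h1"
      using step[OF *] by simp
  qed (use that in auto)
  have "I (Suc d ^ n) r' h" if "keep 16 r r'" "r' 16 = Suc d ^ n" for r'
  proof -
    have "state_index d n y < Suc d ^ n" if "valid d n y" for y
      using that by (intro state_index_less) (simp add: valid_def)
    then show ?thesis using that h by (auto simp: I_def table_def full_def)
  qed
  moreover have r10: "r 10 = Suc d ^ n" using r by (simp add: static_def)
  ultimately have "vc (Blk [LoadConst 16 0, Add 16 16 10]) (wp (While [] 16 (Blk [Sub 16 16 5] ;; c ;; odometer))
      (Suc d ^ n * (T + n * 18 + 7) + 1) ?Q) r h"
    using wp_mono[OF loop] r10 by simp
  then show ?thesis unfolding sweep_def by (rule wp_vc_Seq) simp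
qed

lemma wp_relax_body:
  assumes r: "static r" "r 15 = v" "r 14 = Suc d ^ v" "r 16 = state_index d n x" and v: "v < n"
    and x: "digits h x" "valid d n x"
    and tab: "table h (\<lambda>y. if state_index d n y \<le> state_index d n x then F y else F' y)"
  shows "wp relax_body 28 (\<lambda>r' h'. keep 17 r r' \<and> h' = h(bA + state_index d n x := relax v F x)) r h"
proof -
  have r': "r 5 = 1" "r 7 = bD" "r 8 = bQ" "r 9 = bA" "r 14 = Suc d ^ v" "r 15 = v" "r 16 = state_index d n x"
    using r by (simp_all add: static_def)
  have dg: "h (bD + v) = x v" "h (bQ + v) = x v mod 2" using x(1) v by (auto simp: digits_def)
  have 0: "h (bA + state_index d n x) = F x" using tab x(2) by (simp add: table_def)
  have xv: "x v \<le> d" using x(2) v by (simp add: valid_def)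
  \<comment> \<open>The predecessor has an index at most that of \<open>x\<close>, so its cell still
    contains the old value, and its address differs by a multiple of the stored weight.\<close>
  have sub: "h (bA + state_index d n x - k * Suc d ^ v) = F (x(v := x v - k)) \<and>
     64 \<le> bA + state_index d n x - k * Suc d ^ v" if "k \<le> x v" for k
  proof -
    let ?y = "x(v := x v - k)"
    have y: "valid d n ?y" using x(2) v xv by (intro valid_upd) auto
    have eq: "state_index d n ?y + k * Suc d ^ v = state_index d n x" using v that by (rule state_index_decr)
    then have "h (bA + state_index d n ?y) = F ?y" using tab y unfolding table_def by (metis le_add1)
    moreover have "bA + state_index d n x - k * Suc d ^ v = bA + state_index d n ?y" using eq by linarith
    ultimately show ?thesis using base by simp
  qed
  have max: "a - b + b = max a b" "a - Suc b + b = max (a - Suc 0) b" for a b :: nat by auto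
  \<comment> \<open>These are the outcomes of the nested tests: digit nonzero, digit odd, digit
    still nonzero after being decremented.\<close>
  consider "x v = 0" | "x v \<noteq> 0" "even (x v)" | "x v = 1" | "odd (x v)" "2 \<le> x v"
    by (metis One_nat_def less_2_cases not_less)
  then have "vc relax_body (\<lambda>r' h'. keep 17 r r' \<and> h' = h(bA + state_index d n x := relax v F x)) r h"
  proof cases
    case 1
    then show ?thesis using base by (simp add: relax_body_def r' dg 0 relax_def)
  next
    case 2
    then show ?thesis using base sub[of 1]
      by (simp add: relax_body_def r' dg 0 relax_def max mod_2_eq_odd)
  next
    case 3
    then show ?thesis using base sub[of 1]
      by (simp add: relax_body_def r' dg 0 relax_def max)
  next
    case 4
    from 4 show ?thesis using base sub[of 1] sub[of 2]
      by (simp add: relax_body_def r' dg 0 relax_def max mod_2_eq_odd mult_2[symmetric] del: power_Suc)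
        (simp add: max.assoc)
  qed
  then show ?thesis by (rule wp_vc_le) (simp add: relax_body_def)
qed

text \<open>The pointer in register 21 runs through the bits in input order, so no address has to be
  computed. An edge is uncovered iff its bit is set and the parities at its ends add up to
  0.\<close>

lemma wp_cover_body:
  assumes r: "static r" "r 12 = p" "r 16 = state_index d n x" and p: "64 \<le> p"
    and x: "digits h x" and val: "h (bA + state_index d n x) = a"
    and bits: "\<And>u v. u < v \<Longrightarrow> v < n \<Longrightarrow>
      h (p + row_start n u + (v - Suc u)) = (if {u, v} \<in> E then 1 else 0)"
  shows "wp cover_body (n * (n * 17 + 10) + 12)
    (\<lambda>r' h'. keep 17 r r' \<and> h' = h(bA + state_index d n x := if covers_at n E x then a else 0)) r h"
proof -
  \<comment> \<open>An uncovered edge occurs before position \<open>(u, v)\<close> in row-major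
    order; the flag in register 20 records this for the part already scanned.\<close>
  define bad where "bad u v \<longleftrightarrow> (\<exists>u' w. u' < w \<and> w < n \<and> {u', w} \<in> E \<and> even (x u') \<and> even (x w) \<and>
    (u' < u \<or> u' = u \<and> w < v))" for u v
  have bad_v: "bad u (Suc v) \<longleftrightarrow> bad u v \<or> {u, v} \<in> E \<and> even (x u) \<and> even (x v)"
    if "u < v" "v < n" for u v
    using that unfolding bad_def less_Suc_eq by blast
  \<comment> \<open>The end of a row is the beginning of the next, and since only pairs above the
    diagonal count, a row effectively begins at \<open>Suc u\<close>.\<close>
  have bad_row: "bad u n \<longleftrightarrow> bad (Suc u) 0" "bad u (Suc u) \<longleftrightarrow> bad u 0" for u
    unfolding bad_def less_Suc_eq by auto
  have bad_n: "bad n 0 \<longleftrightarrow> \<not> covers_at n E x"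
    unfolding bad_def covers_at_def by (auto dest: less_trans)
  have bad_0: "\<not> bad 0 0" by (simp add: bad_def)
  have row_Suc: "row_start n (Suc u) = row_start n u + (n - Suc u)" for u by (simp add: row_start_def)
  have dg: "h (bQ + v) = x v mod 2" if "v < n" for v using x that by (simp add: digits_def)
  define J where "J u i r' h' \<longleftrightarrow> h' = h \<and> keep 20 r r' \<and> i = n - r' 23 \<and> u < r' 23 \<and> r' 23 \<le> n \<and>
    r' 22 = u \<and> r' 24 = x u mod 2 \<and> r' 21 = p + row_start n u + (r' 23 - Suc u) \<and>
    (r' 20 = 0 \<longleftrightarrow> \<not> bad u (r' 23))" for u i r' h'
  define I where "I i r' h' \<longleftrightarrow> h' = h \<and> keep 20 r r' \<and> i = n - r' 22 \<and> r' 22 \<le> n \<and>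
    r' 21 = p + row_start n (r' 22) \<and> (r' 20 = 0 \<longleftrightarrow> \<not> bad (r' 22) 0)" for i r' h'
  have regs: "r1 0 = n \<and> r1 5 = 1 \<and> r1 8 = bQ \<and> r1 9 = bA \<and> r1 12 = p \<and> r1 16 = state_index d n x"
    if "keep 20 r r1" for r1
    using r that by (simp add: static_def keep_def)
  let ?inner = "Blk [LoadInd 25 21, Add 21 21 5] ;;
         If 25
           (Blk [Add 26 8 23, LoadInd 26 26, Add 26 26 24] ;;
            If 26 (Blk []) (Blk [LoadConst 20 1]))
           (Blk []) ;;
         Blk [Add 23 23 5]"
  have inner_step: "wp ?inner 13 (\<lambda>r h. \<exists>j<i. J u j (r(63 := 0)) h) r1 h1"
    if J: "J u i r1 h1" and less: "r1 23 < n" for u i r1 h1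
  proof -
    define v where "v = r1 23"
    have k: "keep 20 r r1" and uv: "u < v" "v < n" and [simp]: "h1 = h" and i: "i = n - v"
      using J less by (auto simp: J_def v_def)
    have reg: "r1 22 = u" "r1 24 = x u mod 2" "r1 21 = p + row_start n u + (v - Suc u)"
      "r1 20 = 0 \<longleftrightarrow> \<not> bad u v" "r1 23 = v"
      using J by (auto simp: J_def v_def)
    have next_: "\<exists>j<i. J u j r' h'" if "h' = h" "keep 20 r r'" "r' 23 = Suc v" "r' 22 = u"
      "r' 24 = x u mod 2" "r' 21 = Suc (p + row_start n u + (v - Suc u))"
      "r' 20 = 0 \<longleftrightarrow> \<not> bad u (Suc v)" for r' h'
      using that uv i by (intro exI[of _ "n - Suc v"]) (auto simp: J_def Suc_diff_Suc)
    show ?thesis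
    proof (rule wp_vc_le)
      show "vc ?inner (\<lambda>r h. \<exists>j<i. J u j (r(63 := 0)) h) r1 h1"
        apply (insert p base(1,2))
        apply (cases "{u, v} \<in> E"; cases "even (x u)"; cases "even (x v)")
        apply (simp_all add: reg regs[OF k] bits[OF uv] dg[OF uv(2)] mod_2_eq_odd)
        apply (rule next_; simp add: reg k bad_v[OF uv] mod_2_eq_odd)+
        done
    qed simp
  qed
  let ?outer = "Blk [Add 24 8 22, LoadInd 24 24, Add 23 22 5] ;;
       While [Sub 30 0 23] 30 ?inner ;; Blk [Add 22 22 5]"
  have outer_step: "wp ?outer (n * 17 + 6) (\<lambda>r h. \<exists>j<i. I j (r(63 := 0)) h) r1 h1"
    if I: "I i r1 h1" and less: "r1 22 < n" for i r1 h1
  proof -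
    define u where "u = r1 22"
    have k: "keep 20 r r1" and u: "u < n" and [simp]: "h1 = h" and i: "i = n - u"
      using I less by (auto simp: I_def u_def)
    have reg: "r1 22 = u" "r1 21 = p + row_start n u" "r1 20 = 0 \<longleftrightarrow> \<not> bad u 0"
      using I by (auto simp: I_def u_def)
    let ?Q = "\<lambda>r h. \<exists>j<i. I j (r(63 := 0)) h"
    have exit: "wp (Blk [Add 22 22 5]) 1 ?Q r2 h2" if J: "J u 0 r2 h2" for r2 h2
    proof -
      have "r2 23 = n" "h2 = h" "keep 20 r r2" using J by (auto simp: J_def)
      moreover have "\<exists>j<i. I j r' h'" if "h' = h" "keep 20 r r'" "r' 22 = Suc u"
        "r' 21 = p + row_start n (Suc u)" "r' 20 = 0 \<longleftrightarrow> \<not> bad (Suc u) 0" for r' h'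
        using that u i by (intro exI[of _ "n - Suc u"]) (auto simp: I_def)
      ultimately show ?thesis
        using J regs[of r2] bad_row(1)[of u] row_Suc[of u] by (intro wp_vc_le) (auto simp: J_def)
    qed
    have loop: "wp (While [Sub 30 0 23] 30 ?inner) (n * 17 + 2) (wp (Blk [Add 22 22 5]) 1 ?Q) r2 h2"
      if "J u (n - Suc u) r2 h2" for r2 h2
    proof (rule wp_While_le[where I="J u" and N="n - Suc u" and T=13])
      fix i r3 h3 assume J: "J u i r3 h3"
      then have k3: "keep 20 r r3" by (simp add: J_def)
      have J': "J u i (r3(30 := c)) h3" for c using J by (simp add: J_def)
      show "blk [Sub 30 0 23] (\<lambda>r h. if r 30 = 0 then wp (Blk [Add 22 22 5]) 1 ?Q r h else 0 < i \<and>
          wp ?inner 13 (\<lambda>r h. \<exists>j<i. J u j (r(63 := 0)) h) r h) r3 h3"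
      proof (cases "r3 23 < n")
        case True
        moreover have "0 < i" using J True by (auto simp: J_def)
        ultimately show ?thesis using regs[OF k3] inner_step[OF J'] by simp
      next
        case False
        then have "r3 23 = n" "i = 0" using J by (auto simp: J_def)
        then show ?thesis using regs[OF k3] exit[of "r3(30 := 0)" h3] J' by simp
      qed
    next
      have "(n - Suc u) * 17 \<le> n * 17" by simp
      then show "(n - Suc u) * (13 + length [Sub 30 0 23] + 3) + length [Sub 30 0 23] + 1 \<le> n * 17 + 2"
        by simp
    qed (use that in auto)
    have "J u (n - Suc u) r' h" if "keep 20 r r'" "r' 23 = Suc u" "r' 22 = u" "r' 24 = x u mod 2"
      "r' 21 = p + row_start n u" "r' 20 = 0 \<longleftrightarrow> \<not> bad u 0" for r'
      using that u by (auto simp: J_def bad_row)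
    then have "wp (While [Sub 30 0 23] 30 ?inner ;; Blk [Add 22 22 5]) (n * 17 + 3) ?Q r' h"
      if "keep 20 r r'" "r' 23 = Suc u" "r' 22 = u" "r' 24 = x u mod 2"
        "r' 21 = p + row_start n u" "r' 20 = 0 \<longleftrightarrow> \<not> bad u 0" for r'
      using that by (intro wp_Seq_le[OF loop]) simp_all
    then have "vc (Blk [Add 24 8 22, LoadInd 24 24, Add 23 22 5])
        (wp (While [Sub 30 0 23] 30 ?inner ;; Blk [Add 22 22 5]) (n * 17 + 3) ?Q) r1 h1"
      using base by (simp add: reg regs[OF k] dg[OF u] k)
    then show ?thesis by (rule wp_vc_Seq) simp
  qed
  let ?Q = "\<lambda>r' h'. keep 17 r r' \<and> h' = h(bA + state_index d n x := if covers_at n E x then a else 0)"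
  let ?last = "If 20 (Blk [Add 26 9 16, LoadConst 27 0, StoreInd 26 27]) (Blk [])"
  have last: "wp ?last 6 ?Q r1 h1" if "I 0 r1 h1" for r1 h1
  proof -
    have k: "keep 20 r r1" and [simp]: "h1 = h" and "r1 20 = 0 \<longleftrightarrow> covers_at n E x"
      using that bad_n by (auto simp: I_def)
    moreover have "keep 17 r r1" using k by (simp add: keep_def)
    ultimately show ?thesis
      using regs[OF k] base val by (intro wp_vc_le) auto
  qed
  have loop: "wp (While [Sub 30 0 22] 30 ?outer) (n * (n * 17 + 10) + 2) (wp ?last 6 ?Q) r1 h1"
    if "I n r1 h1" for r1 h1
  proof (rule wp_While_le[where I=I and N=n and T="n * 17 + 6"])
    fix i r3 h3 assume I: "I i r3 h3"
    then have k3: "keep 20 r r3" by (simp add: I_def)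
    have I': "I i (r3(30 := c)) h3" for c using I by (simp add: I_def)
    show "blk [Sub 30 0 22] (\<lambda>r h. if r 30 = 0 then wp ?last 6 ?Q r h else 0 < i \<and>
        wp ?outer (n * 17 + 6) (\<lambda>r h. \<exists>j<i. I j (r(63 := 0)) h) r h) r3 h3"
    proof (cases "r3 22 < n")
      case True
      moreover have "0 < i" using I True by (auto simp: I_def)
      ultimately show ?thesis using regs[OF k3] outer_step[OF I'] by simp
    next
      case False
      then have "r3 22 = n" "i = 0" using I by (auto simp: I_def)
      then show ?thesis using regs[OF k3] last[of "r3(30 := 0)" h3] I' by simp
    qed
  qed (use that in auto)
  have "I n r' h" if "keep 20 r r'" "r' 22 = 0" "r' 21 = p" "r' 20 = 0" for r'
    using that bad_0 by (auto simp: I_def row_start_def)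
  then have "wp (While [Sub 30 0 22] 30 ?outer ;; ?last) (n * (n * 17 + 10) + 8) ?Q r' h"
    if "keep 20 r r'" "r' 22 = 0" "r' 21 = p" "r' 20 = 0" for r'
    using that by (intro wp_Seq_le[OF loop]) simp_all
  then have "vc (Blk [LoadConst 20 0, LoadConst 21 0, Add 21 21 12, LoadConst 22 0])
      (wp (While [Sub 30 0 22] 30 ?outer ;; ?last) (n * (n * 17 + 10) + 8) ?Q) r h"
    using r by simp
  then show ?thesis unfolding cover_body_def by (rule wp_vc_Seq) simp
qed

end

section \<open>One time step, the loop over time, and reading off the answer\<close>

definition round_prog :: com where
  "round_prog =
     Blk [Sub 13 13 5, LoadConst 14 0, Add 14 14 5, LoadConst 15 0] ;;
     While [Sub 30 0 15] 30 (sweep relax_body ;; mult_step ;; Blk [Add 15 15 5]) ;;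
     sweep cover_body ;;
     Blk [Add 12 12 11]"

definition rounds_prog :: com where
  "rounds_prog =
     Blk [LoadConst 12 0, Add 12 12 6, LoadConst 13 0, Add 13 13 1] ;;
     While [] 13 round_prog"

definition answer_prog :: com where
  "answer_prog =
     Blk [LoadConst 20 0, LoadConst 21 0, Add 21 21 10] ;;
     While [] 21 (Blk [Sub 21 21 5, Add 22 9 21, LoadInd 22 22, Add 20 20 22]) ;;
     Blk [LoadConst 0 0, Add 0 0 20]"

text \<open>The sum of the nested loop bounds: \<open>n\<close> relaxing sweeps, each followed by a
  weight update costing about \<open>5 * d\<close>, and one covering sweep whose body is quadratic
  in \<open>n\<close>.\<close>

definition round_time :: "nat \<Rightarrow> nat \<Rightarrow> nat" where
  "round_time n d = n * (Suc d ^ n * (n * 18 + 35) + d * 5 + 15) +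
     Suc d ^ n * (n * (n * 17 + 28) + 19) + 10"

context layout
begin

text \<open>The bound by \<open>bD\<close> places the bits in the region that sweeps
  preserve.\<close>

definition snapshot :: "(nat \<Rightarrow> nat) \<Rightarrow> nat \<Rightarrow> nat set set \<Rightarrow> bool" where
  "snapshot h p E \<longleftrightarrow> 64 \<le> p \<and> (\<forall>u v. u < v \<longrightarrow> v < n \<longrightarrow> p + row_start n u + (v - Suc u) < bD \<and>
     h (p + row_start n u + (v - Suc u)) = (if {u, v} \<in> E then 1 else 0))"

lemma wp_round:
  assumes r: "static r" "r 12 = p" and h: "full h" "table h F" "snapshot h p E"
  shows "wp round_prog (round_time n d) (\<lambda>r' h'. keep 12 r r' \<and> r' 13 = r 13 - 1 \<and> r' 12 = p + M \<and>
    (\<forall>a<bD. h' a = h a) \<and> full h' \<and>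
    table h' (\<lambda>x. if covers_at n E x then relax_upto n F x else 0)) r h"
proof -
  let ?Q = "\<lambda>r' h'. keep 12 r r' \<and> r' 13 = r 13 - 1 \<and> r' 12 = p + M \<and>
    (\<forall>a<bD. h' a = h a) \<and> full h' \<and>
    table h' (\<lambda>x. if covers_at n E x then relax_upto n F x else 0)"
  let ?r = "r(13 := r 13 - 1)"
  define I where "I i r' h' \<longleftrightarrow> keep 14 ?r r' \<and> r' 15 \<le> n \<and> i = n - r' 15 \<and> r' 14 = Suc d ^ r' 15 \<and>
    (\<forall>a<bD. h' a = h a) \<and> full h' \<and> table h' (relax_upto (r' 15) F)" for i r' h'
  have regs: "r1 0 = n" "r1 5 = 1" "r1 2 = d" "r1 11 = M" "r1 12 = p" "r1 13 = r 13 - 1"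
    "static r1" "keep 12 r r1" if "keep 14 ?r r1" for r1
    using r that by (simp_all add: static_def keep_def)
  let ?inner = "sweep relax_body ;; mult_step ;; Blk [Add 15 15 5]"
  let ?T = "Suc d ^ n * (n * 18 + 35) + d * 5 + 11"
  have inner_step: "wp ?inner ?T (\<lambda>r h. \<exists>j<i. I j (r(63 := 0)) h) r1 h1"
    if I: "I i r1 h1" and less: "r1 15 < n" for i r1 h1
  proof -
    define v where "v = r1 15"
    have k: "keep 14 ?r r1" and v: "v < n" "r1 15 = v" and i: "i = n - v" and w: "r1 14 = Suc d ^ v"
      and fr: "\<forall>a<bD. h1 a = h a" and tp: "full h1" and tab: "table h1 (relax_upto v F)"
      using I less by (auto simp: I_def v_def)
    note reg = regs[OF k]
    have exit: "wp (mult_step ;; Blk [Add 15 15 5]) (d * 5 + 8) (\<lambda>r h. \<exists>j<i. I j (r(63 := 0)) h) r2 h2"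
      if k2: "keep 16 r1 r2" and *: "\<forall>a<bD. h2 a = h1 a" "full h2" "table h2 (relax_upto (Suc v) F)"
      for r2 h2
    proof -
      have k2': "keep 14 ?r r2" by (rule keep_trans[OF k keep_trans[OF k2 keep_refl]]) auto
      note reg2 = regs[OF k2']
      have r2: "r2 15 = v" "r2 14 = Suc d ^ v" using k2 v w by (simp_all add: keep_def)
      have end_: "\<exists>j<i. I j r' h'" if "keep 14 r2 r'" "r' 14 = Suc d ^ Suc v" "r' 15 = Suc v" "h' = h2"
        for r' h'
      proof -
        have "keep 14 ?r r'" using k2' that(1) by (simp add: keep_def)
        then have "I (n - Suc v) r' h'" using that v fr * by (simp add: I_def)
        then show ?thesis using i v by (intro exI[of _ "n - Suc v"]) auto
      qed
      show ?thesis
      proof (rule wp_Seq_le[OF wp_mono[OF wp_mult_step[OF reg2(2,3)] order_refl], where T=1], elim conjE)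
        fix r3 h3 assume "h3 = h2" "r3 14 = r2 14 * Suc d" "keep 14 r2 r3"
          "\<forall>i. 14 < i \<and> i < 20 \<longrightarrow> r3 i = r2 i"
        moreover have "r3 5 = 1" using calculation reg2(2) by (simp add: keep_def)
        ultimately show "wp (Blk [Add 15 15 5]) 1 (\<lambda>r h. \<exists>j<i. I j (r(63 := 0)) h) r3 h3"
          using r2 by (intro wp_vc_le) (auto intro!: end_)
      qed simp
    qed
    have "wp (sweep relax_body) (Suc d ^ n * (28 + n * 18 + 7) + 3)
      (wp (mult_step ;; Blk [Add 15 15 5]) (d * 5 + 8) (\<lambda>r h. \<exists>j<i. I j (r(63 := 0)) h)) r1 h1"
    proof (rule wp_mono[OF wp_sweep[OF reg(7) tp tab] order_refl])
      fix r' h' x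
      assume k': "keep 16 r1 r'" and x: "digits h' x" "valid d n x" and r': "r' 16 = state_index d n x"
        and tab': "table h' (\<lambda>y. if state_index d n y \<le> state_index d n x then relax_upto v F y else relax_upto (Suc v) F y)"
      have "r' 15 = v" "r' 14 = Suc d ^ v" using k' v w by (simp_all add: keep_def)
      from wp_relax_body[OF static_keep[OF reg(7) k'] this r' v(1) x tab'[unfolded relax_upto.simps]]
      show "wp relax_body 28 (\<lambda>r'' h''. keep 17 r' r'' \<and> h'' = h'(bA + state_index d n x := relax_upto (Suc v) F x)) r' h'"
        by simp
    qed (use exit in auto)
    then show ?thesis by (rule wp_Seq_le) simp
  qed
  let ?C = "n * (n * 17 + 10) + 12"
  let ?last = "sweep cover_body ;; Blk [Add 12 12 11]"
  have last: "wp ?last (Suc d ^ n * (?C + n * 18 + 7) + 4) ?Q r1 h1" if I: "I 0 r1 h1" for r1 h1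
  proof -
    have k: "keep 14 ?r r1" and fr: "\<forall>a<bD. h1 a = h a" and tp: "full h1"
      and tab: "table h1 (relax_upto n F)"
      using I by (auto simp: I_def)
    note reg = regs[OF k]
    show ?thesis
    proof (rule wp_Seq_le[OF wp_mono[OF wp_sweep[OF reg(7) tp tab, where T="?C" and
          F'="\<lambda>x. if covers_at n E x then relax_upto n F x else 0"] order_refl], where T=1])
      fix r' h' x
      assume k': "keep 16 r1 r'" and fr': "\<forall>a<bD. h' a = h1 a"
        and x: "digits h' x" "valid d n x" and r': "r' 16 = state_index d n x"
        and tab': "table h' (\<lambda>y. if state_index d n y \<le> state_index d n x then relax_upto n F y
          else if covers_at n E y then relax_upto n F y else 0)"
      have "r' 12 = p" using k' reg by (simp add: keep_def)
      moreover have "64 \<le> p" using h(3) by (simp add: snapshot_def)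
      moreover have "h' (bA + state_index d n x) = relax_upto n F x" using tab' x(2) by (simp add: table_def)
      ultimately show "wp cover_body ?C (\<lambda>r'' h''. keep 17 r' r'' \<and>
          h'' = h'(bA + state_index d n x := if covers_at n E x then relax_upto n F x else 0)) r' h'"
      proof (intro wp_cover_body[OF static_keep[OF reg(7) k'] _ r' _ x(1)])
        fix u v assume "u < v" "v < n"
        then have "p + row_start n u + (v - Suc u) < bD"
          "h (p + row_start n u + (v - Suc u)) = (if {u, v} \<in> E then 1 else 0)"
          using h(3) unfolding snapshot_def by blast+
        then show "h' (p + row_start n u + (v - Suc u)) = (if {u, v} \<in> E then 1 else 0)"
          using fr fr' by metis
      qed simp_all
    next
      fix r2 h2
      assume *: "keep 16 r1 r2 \<and> (\<forall>a<bD. h2 a = h1 a) \<and> full h2 \<and>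
        table h2 (\<lambda>x. if covers_at n E x then relax_upto n F x else 0)"
      then have "r2 11 = M" "r2 12 = p" "r2 13 = r 13 - 1" "keep 12 r r2"
        using reg by (simp_all add: keep_def)
      then show "wp (Blk [Add 12 12 11]) 1 ?Q r2 h2"
        using * fr by (intro wp_vc_le) auto
    qed simp
  qed
  have loop: "wp (While [Sub 30 0 15] 30 ?inner ;; ?last)
      (n * (?T + 4) + 2 + (Suc d ^ n * (?C + n * 18 + 7) + 4)) ?Q r1 h1"
    if "I n r1 h1" for r1 h1
  proof (rule wp_Seq, rule wp_While_le[where I=I and N=n and T="?T"])
    fix i r3 h3 assume I: "I i r3 h3"
    then have k3: "keep 14 ?r r3" by (simp add: I_def)
    have I': "I i (r3(30 := c)) h3" for c using I by (simp add: I_def)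
    show "blk [Sub 30 0 15] (\<lambda>r h. if r 30 = 0 then wp ?last (Suc d ^ n * (?C + n * 18 + 7) + 4) ?Q r h
        else 0 < i \<and> wp ?inner ?T (\<lambda>r h. \<exists>j<i. I j (r(63 := 0)) h) r h) r3 h3"
    proof (cases "r3 15 < n")
      case True
      moreover have "0 < i" using I True by (auto simp: I_def)
      ultimately show ?thesis using regs(1)[OF k3] inner_step[OF I'] by simp
    next
      case False
      then have "r3 15 = n" "i = 0" using I by (auto simp: I_def)
      then show ?thesis using regs(1)[OF k3] last[of "r3(30 := 0)" h3] I' by simp
    qed
  qed (use that in auto)
  have "I n r' h" if "keep 14 ?r r'" "r' 15 = 0" "r' 14 = 1" for r'
    using that h by (auto simp: I_def)
  then have "wp (While [Sub 30 0 15] 30 ?inner ;; ?last)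
      (n * (?T + 4) + 2 + (Suc d ^ n * (?C + n * 18 + 7) + 4)) ?Q r' h"
    if "keep 14 ?r r'" "r' 15 = 0" "r' 14 = 1" for r'
    using that by (intro loop) simp
  then have "vc (Blk [Sub 13 13 5, LoadConst 14 0, Add 14 14 5, LoadConst 15 0])
     (wp (While [Sub 30 0 15] 30 ?inner ;; ?last)
      (n * (?T + 4) + 2 + (Suc d ^ n * (?C + n * 18 + 7) + 4)) ?Q) r h"
    using r by (simp add: static_def)
  then show ?thesis unfolding round_prog_def
    by (rule wp_vc_Seq) (simp add: round_time_def algebra_simps)
qed

lemma wp_rounds:
  assumes r: "static r" and h: "full h" "table h (budget n E L 0)"
    and E: "\<And>t. t < \<tau> \<Longrightarrow> snapshot h (bB + t * M) (E (Suc t))"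
  shows "wp rounds_prog (\<tau> * (round_time n d + 3) + 5)
    (\<lambda>r' h'. static r' \<and> table h' (budget n E L \<tau>)) r h"
proof -
  let ?Q = "\<lambda>r' h'. static r' \<and> table h' (budget n E L \<tau>)"
  define I where "I i r' h' \<longleftrightarrow> keep 12 r r' \<and> r' 13 = i \<and> i \<le> \<tau> \<and> r' 12 = bB + (\<tau> - i) * M \<and>
    (\<forall>a<bD. h' a = h a) \<and> full h' \<and> table h' (budget n E L (\<tau> - i))" for i r' h'
  have step: "wp round_prog (round_time n d) (\<lambda>r h. \<exists>j<i. I j (r(63 := 0)) h) r1 h1"
    if I: "I i r1 h1" and i: "0 < i" for i r1 h1
  proof -
    have k: "keep 12 r r1" and *: "r1 13 = i" "i \<le> \<tau>" "r1 12 = bB + (\<tau> - i) * M"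
      "\<forall>a<bD. h1 a = h a" "full h1" "table h1 (budget n E L (\<tau> - i))"
      using I by (auto simp: I_def)
    have snap: "snapshot h1 (bB + (\<tau> - i) * M) (E (Suc (\<tau> - i)))"
      using E[of "\<tau> - i"] *(2,4) i by (simp add: snapshot_def)
    have r1: "static r1" using static_keep[OF r k] by simp
    show ?thesis
    proof (rule wp_mono[OF wp_round[OF r1 *(3,5,6) snap] order_refl], elim conjE)
      fix r2 h2 assume **: "keep 12 r1 r2" "r2 13 = r1 13 - 1" "r2 12 = bB + (\<tau> - i) * M + M"
        "\<forall>a<bD. h2 a = h1 a" "full h2"
        "table h2 (\<lambda>x. if covers_at n (E (Suc (\<tau> - i))) x then relax_upto n (budget n E L (\<tau> - i)) x else 0)"
      have "keep 12 r r2" by (rule keep_trans[OF k **(1)]) simp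
      moreover have eq: "\<tau> - (i - 1) = Suc (\<tau> - i)" using *(2) i by simp
      moreover have "(\<lambda>x. if covers_at n (E (Suc (\<tau> - i))) x then relax_upto n (budget n E L (\<tau> - i)) x else 0)
          = budget n E L (Suc (\<tau> - i))" by auto
      ultimately have "I (i - 1) (r2(63 := 0)) h2"
        using * ** i unfolding I_def eq by simp
      then show "\<exists>j<i. I j (r2(63 := 0)) h2" using i by (intro exI[of _ "i - 1"]) auto
    qed
  qed
  have loop: "wp (While [] 13 round_prog) (\<tau> * (round_time n d + 3) + 1) ?Q r1 h1" if "I \<tau> r1 h1" for r1 h1
  proof (rule wp_While_le[where I=I and N=\<tau> and T="round_time n d"])
    fix i r3 h3 assume I: "I i r3 h3"
    show "blk [] (\<lambda>r h. if r 13 = 0 then ?Q r h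
        else 0 < i \<and> wp round_prog (round_time n d) (\<lambda>r h. \<exists>j<i. I j (r(63 := 0)) h) r h) r3 h3"
    proof (cases "i = 0")
      case True
      then show ?thesis using I static_keep[OF r, of 12 r3] by (simp add: I_def)
    next
      case False
      then show ?thesis using I step[OF I] by (simp add: I_def)
    qed
  qed (use that in auto)
  have "I \<tau> r' h" if "keep 12 r r'" "r' 13 = \<tau>" "r' 12 = bB" for r'
    using that h by (simp add: I_def)
  then have "wp (While [] 13 round_prog) (\<tau> * (round_time n d + 3) + 1) ?Q r' h"
    if "keep 12 r r'" "r' 13 = \<tau>" "r' 12 = bB" for r'
    using that by (intro loop) simp
  then have "vc (Blk [LoadConst 12 0, Add 12 12 6, LoadConst 13 0, Add 13 13 1])
      (wp (While [] 13 round_prog) (\<tau> * (round_time n d + 3) + 1) ?Q) r h"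
    using r by (simp add: static_def)
  then show ?thesis unfolding rounds_prog_def by (rule wp_vc_Seq) simp
qed

text \<open>The entries are added up, as a sum of natural numbers is nonzero iff one of them is.
  Scanning addresses is enough because every index below the table size belongs to a valid
  state.\<close>

lemma wp_answer:
  assumes r: "static r" and tab: "table h F"
  shows "wp answer_prog (Suc d ^ n * 7 + 6)
    (\<lambda>r' h'. (r' 0 \<noteq> 0) = (\<exists>x. valid d n x \<and> F x \<noteq> 0)) r h"
proof -
  let ?Q = "\<lambda>r' h'. (r' 0 \<noteq> 0) = (\<exists>x. valid d n x \<and> F x \<noteq> 0)"
  let ?N = "Suc d ^ n"
  let ?body = "Blk [Sub 21 21 5, Add 22 9 21, LoadInd 22 22, Add 20 20 22]"
  define I where "I i r' h' \<longleftrightarrow> h' = h \<and> keep 20 r r' \<and> r' 21 = i \<and>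
    (r' 20 = 0 \<longleftrightarrow> (\<forall>s. i \<le> s \<and> s < ?N \<longrightarrow> h (bA + s) = 0))" for i r' h'
  have regs: "r1 5 = 1" "r1 9 = bA" "r1 10 = ?N" if "keep 20 r r1" for r1
    using r that by (simp_all add: static_def keep_def)
  have step: "wp ?body 4 (\<lambda>r h. \<exists>j<i. I j (r(63 := 0)) h) r1 h1"
    if I: "I i r1 h1" and i: "0 < i" "i \<le> ?N" for i r1 h1
  proof -
    have k: "keep 20 r r1" and "r1 21 = i" "h1 = h" using I by (auto simp: I_def)
    have "(\<forall>s. i - 1 \<le> s \<and> s < ?N \<longrightarrow> h (bA + s) = 0) \<longleftrightarrow>
        h (bA + (i - 1)) = 0 \<and> (\<forall>s. i \<le> s \<and> s < ?N \<longrightarrow> h (bA + s) = 0)"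
    proof -
      have "i - 1 \<le> s \<longleftrightarrow> s = i - 1 \<or> i \<le> s" for s using i(1) by auto
      then show ?thesis using i by auto
    qed
    then have "\<exists>j<i. I j r' h" if "keep 20 r r'" "r' 21 = i - 1"
      "r' 20 = r1 20 + h (bA + (i - 1))" for r'
      using that I i by (intro exI[of _ "i - 1"]) (auto simp: I_def)
    then show ?thesis
      using base i k regs[OF k] \<open>r1 21 = i\<close> \<open>h1 = h\<close> by (intro wp_vc_le) simp_all
  qed
  have exit: "wp (Blk [LoadConst 0 0, Add 0 0 20]) 2 ?Q r1 h1" if I: "I 0 r1 h1" for r1 h1
  proof -
    have "(\<exists>s<?N. h (bA + s) \<noteq> 0) \<longleftrightarrow> (\<exists>x. valid d n x \<and> F x \<noteq> 0)"
    proof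
      assume "\<exists>s<?N. h (bA + s) \<noteq> 0"
      then obtain s x where "valid d n x" "state_index d n x = s" "h (bA + s) \<noteq> 0" by (metis state_index_surj)
      then show "\<exists>x. valid d n x \<and> F x \<noteq> 0" using tab by (auto simp: table_def)
    next
      assume "\<exists>x. valid d n x \<and> F x \<noteq> 0"
      then obtain x where "valid d n x" "F x \<noteq> 0" by blast
      moreover from this have "state_index d n x < ?N" by (intro state_index_less) (simp add: valid_def)
      ultimately show "\<exists>s<?N. h (bA + s) \<noteq> 0" using tab by (auto simp: table_def)
    qed
    then show ?thesis using I by (intro wp_vc_le) (auto simp: I_def)
  qed
  have loop: "wp (While [] 21 ?body ;; Blk [LoadConst 0 0, Add 0 0 20]) (?N * 7 + 1 + 2) ?Q r1 h1"
    if "I ?N r1 h1" for r1 h1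
  proof (rule wp_Seq, rule wp_While_le[where I=I and N="?N" and T=4])
    fix i r3 h3 assume I: "I i r3 h3" "i \<le> ?N"
    show "blk [] (\<lambda>r h. if r 21 = 0 then wp (Blk [LoadConst 0 0, Add 0 0 20]) 2 ?Q r h
        else 0 < i \<and> wp ?body 4 (\<lambda>r h. \<exists>j<i. I j (r(63 := 0)) h) r h) r3 h3"
    proof (cases "i = 0")
      case True
      then show ?thesis using I exit[of r3 h3] by (simp add: I_def)
    next
      case False
      then show ?thesis using I step[OF I(1) _ I(2)] by (simp add: I_def)
    qed
  qed (use that in auto)
  have "I ?N r' h" if "keep 20 r r'" "r' 21 = ?N" "r' 20 = 0" for r'
    using that by (auto simp: I_def)
  then have "wp (While [] 21 ?body ;; Blk [LoadConst 0 0, Add 0 0 20]) (?N * 7 + 1 + 2) ?Q r' h"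
    if "keep 20 r r'" "r' 21 = ?N" "r' 20 = 0" for r'
    using that by (intro loop) simp
  then have "vc (Blk [LoadConst 20 0, LoadConst 21 0, Add 21 21 10])
      (wp (While [] 21 ?body ;; Blk [LoadConst 0 0, Add 0 0 20]) (?N * 7 + 1 + 2) ?Q) r h"
    using regs[OF keep_refl] by simp
  then show ?thesis unfolding answer_prog_def by (rule wp_vc_Seq) simp
qed

end

text \<open>The frequent special case in which the tested register is itself the variant and drops
  by exactly one.\<close>

lemma wp_countdown:
  assumes "I N r h"
    and "\<And>i r h. I i r h \<Longrightarrow> r x = i"
    and "\<And>i r h. I (Suc i) r h \<Longrightarrow> i < N \<Longrightarrow> wp c T (\<lambda>r h. I i (r(63 := 0)) h) r h"
    and "\<And>r h. I 0 r h \<Longrightarrow> Q r h"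
    and "x < 64" "N * (T + 3) + 1 \<le> U"
  shows "wp (While [] x c) U Q r h"
proof (rule wp_While_le[where I=I and N=N and T=T])
  fix i r h assume I: "I i r h" "i \<le> N"
  show "blk [] (\<lambda>r h. if r x = 0 then Q r h
      else 0 < i \<and> wp c T (\<lambda>r h. \<exists>j<i. I j (r(63 := 0)) h) r h) r h"
  proof (cases i)
    case 0
    then show ?thesis using I assms(2)[OF I(1)] assms(4) by simp
  next
    case (Suc j)
    have "wp c T (\<lambda>r h. \<exists>j<i. I j (r(63 := 0)) h) r h"
      by (rule wp_mono[OF assms(3)[of j r h] order_refl]) (use I Suc in auto)
    then show ?thesis using Suc assms(2)[OF I(1)] by simp
  qed
qed (use assms in auto)

section \<open>Freeing the registers\<close>

text \<open>The input occupies the low cells, including those needed as registers. The bits in cells 4 to 63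
  are therefore first packed into the single number in cell 4.\<close>

fun bin :: "nat list \<Rightarrow> nat" where
  "bin [] = 0"
| "bin (b # bs) = b * 2 ^ length bs + bin bs"

lemma foldl_bin: "foldl (\<lambda>a b. 2 * a + b) a bs = a * 2 ^ length bs + bin bs"
  by (induction bs arbitrary: a) (auto simp: algebra_simps)

lemma bin_less: "\<forall>b\<in>set bs. b \<le> 1 \<Longrightarrow> bin bs < 2 ^ length bs"
proof (induction bs)
  case (Cons b bs)
  then have "b = 0 \<or> b = 1" "bin bs < 2 ^ length bs" by force+
  then show ?case by auto
qed simp

text \<open>Horner's scheme, unrolled: cells 0 to 3 hold the parameters and all other registers may
  hold input bits, so there is no cell for a loop counter or a pointer.\<close>

definition pack_code :: "nat list \<Rightarrow> instr list" where
  "pack_code js = concat (map (\<lambda>j. [Add 4 4 4, Add 4 4 j]) js)"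

lemma blk_pack_code:
  assumes "\<forall>j\<in>set js. j < 64 \<and> j \<noteq> 4"
  shows "blk (pack_code js) Q r h \<longleftrightarrow> Q (r(4 := foldl (\<lambda>a b. 2 * a + b) (r 4) (map r js))) h"
  using assms
proof (induction js arbitrary: r)
  case (Cons j js)
  have map_eq: "map (r(4 := 2 * r 4 + r j)) js = map r js" using Cons.prems by auto
  have "blk (pack_code (j # js)) Q r h \<longleftrightarrow> blk (pack_code js) Q (r(4 := 2 * r 4 + r j)) h"
    using Cons.prems by (simp add: pack_code_def mult_2)
  then show ?case using Cons by (simp del: fun_upd_apply add: fun_upd_same map_eq)
qed (simp add: pack_code_def)

lemma length_pack_code [simp]: "length (pack_code js) = 2 * length js"
  by (induction js) (auto simp: pack_code_def)

text \<open>Leading bits are extracted by comparison, without division. As the tail is below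
  \<open>2 ^ l\<close>, the leading bit is 1 iff the number is at least \<open>2 ^ l\<close>; adding
  1 before the truncated subtraction turns this into a test for nonzero.\<close>

fun unpack_prog :: "nat \<Rightarrow> com" where
  "unpack_prog 0 = Blk []"
| "unpack_prog (Suc l) =
     Blk [LoadConst 21 (2 ^ l), Add 22 23 5, Sub 22 22 21] ;;
     If 22 (Blk [StoreInd 20 5, Sub 23 23 21]) (Blk [LoadConst 22 0, StoreInd 20 22]) ;;
     Blk [Add 20 20 5] ;;
     unpack_prog l"

lemma max_steps_unpack_prog [simp]: "max_steps (unpack_prog l) = l * 11"
  by (induction l) auto

lemma vc_unpack_prog:
  assumes "\<forall>b\<in>set bs. b \<le> 1" "r 5 = 1" "r 20 = q" "r 23 = bin bs" "64 \<le> q" "keep 20 r0 r"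
    and "\<And>r' h'. keep 20 r0 r' \<Longrightarrow> \<forall>j<length bs. h' (q + j) = bs ! j \<Longrightarrow>
      \<forall>a. a < q \<or> q + length bs \<le> a \<longrightarrow> h' a = h a \<Longrightarrow> Q r' h'"
  shows "vc (unpack_prog (length bs)) Q r h"
  using assms
proof (induction bs arbitrary: r h q)
  case Nil
  then show ?case by simp
next
  case (Cons b bs)
  have less: "bin bs < 2 ^ length bs" using Cons.prems(1) by (intro bin_less) simp
  have rest: "vc (unpack_prog (length bs)) Q r' (h(q := b))"
    if "keep 20 r0 r'" "r' 5 = 1" "r' 20 = Suc q" "r' 23 = bin bs" for r'
  proof (rule Cons.IH[OF _ that(2,3,4) _ that(1)])
    fix r'' h''
    assume *: "keep 20 r0 r''" "\<forall>j<length bs. h'' (Suc q + j) = bs ! j"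
      "\<forall>a. a < Suc q \<or> Suc q + length bs \<le> a \<longrightarrow> h'' a = (h(q := b)) a"
    have "h'' (q + j) = (b # bs) ! j" if "j < length (b # bs)" for j
      using that * by (cases j) auto
    then show "Q r'' h''" using * by (intro Cons.prems(7)) auto
  qed (use Cons.prems in auto)
  from Cons.prems(1) consider "b = 0" | "b = 1" by force
  then show ?case
  proof cases
    case 1
    then show ?thesis using Cons.prems(2-6) less rest by simp
  next
    case 2
    then show ?thesis using Cons.prems(2-6) less rest by simp
  qed
qed

text \<open>With \<open>N\<close> bits in total, the target begins at \<open>64 + N\<close>, above
  all source cells, so nothing is overwritten before it is read. The 60 unpacked bits are followed
  by \<open>N\<close> copied cells, including some zeros past the input; this is why the digits
  begin at \<open>124 + N + N\<close>.\<close>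

definition copy_prog :: com where
  "copy_prog =
     Blk [LoadConst 20 0, Add 20 20 6, LoadConst 23 0, Add 23 23 4] ;;
     unpack_prog 60 ;;
     Blk [LoadConst 20 64, LoadConst 21 60, Add 21 21 6, LoadConst 22 0, Add 22 22 12] ;;
     While [] 22 (Blk [LoadInd 23 20, StoreInd 21 23, Add 20 20 5, Add 21 21 5, Sub 22 22 5])"

lemma wp_copy_prog:
  assumes r: "r 4 = bin bs" "r 5 = 1" "r 6 = 64 + N" "r 12 = N"
    and bs: "length bs = 60" "\<forall>b\<in>set bs. b \<le> 1"
  shows "wp copy_prog (N * 8 + 670) (\<lambda>r' h'. keep 20 r r' \<and>
    (\<forall>j<60. h' (64 + N + j) = bs ! j) \<and> (\<forall>j<N. h' (64 + N + 60 + j) = h (64 + j)) \<and>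
    (\<forall>a\<ge>64 + N + 60 + N. h' a = h a)) r h"
proof -
  let ?Q = "\<lambda>r' h'. keep 20 r r' \<and>
    (\<forall>j<60. h' (64 + N + j) = bs ! j) \<and> (\<forall>j<N. h' (64 + N + 60 + j) = h (64 + j)) \<and>
    (\<forall>a\<ge>64 + N + 60 + N. h' a = h a)"
  let ?c = "Blk [LoadInd 23 20, StoreInd 21 23, Add 20 20 5, Add 21 21 5, Sub 22 22 5]"
  define I where "I i r' h' \<longleftrightarrow> r' 22 = i \<and> keep 20 r r' \<and> i \<le> N \<and> r' 20 = 64 + (N - i) \<and>
    r' 21 = 124 + N + (N - i) \<and> (\<forall>j<60. h' (64 + N + j) = bs ! j) \<and>
    (\<forall>j<N - i. h' (124 + N + j) = h (64 + j)) \<and>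
    (\<forall>a. a < 64 + N \<or> 124 + N + (N - i) \<le> a \<longrightarrow> h' a = h a)" for i r' h'
  have step: "wp ?c 5 (\<lambda>r h. I i (r(63 := 0)) h) r1 h1" if I: "I (Suc i) r1 h1" for i r1 h1
  proof -
    from I have k: "keep 20 r r1" and i: "Suc i \<le> N" and reg: "r1 22 = Suc i"
      "r1 20 = 64 + (N - Suc i)" "r1 21 = 124 + N + (N - Suc i)"
      and hb: "\<forall>j<60. h1 (64 + N + j) = bs ! j" "\<forall>j<N - Suc i. h1 (124 + N + j) = h (64 + j)"
      and fr: "\<forall>a. a < 64 + N \<or> 124 + N + (N - Suc i) \<le> a \<longrightarrow> h1 a = h a"
      by (auto simp: I_def)
    let ?h = "h1(124 + N + (N - Suc i) := h (64 + (N - Suc i)))"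
    have next_: "I i r' ?h" if "keep 20 r r'" "r' 22 = i" "r' 20 = Suc (64 + (N - Suc i))"
      "r' 21 = Suc (124 + N + (N - Suc i))" for r'
    proof -
      have N: "N - i = Suc (N - Suc i)" using i by simp
      show ?thesis unfolding I_def N using that hb fr i by (auto simp: less_Suc_eq)
    qed
    have "h1 (64 + (N - Suc i)) = h (64 + (N - Suc i))" using fr i by auto
    moreover have "r1 5 = 1" using k r by (simp add: keep_def)
    ultimately show ?thesis
      using reg k next_ by (intro wp_vc_le) simp_all
  qed
  have loop: "wp (While [] 22 ?c) (N * 8 + 1) ?Q r1 h1" if "I N r1 h1" for r1 h1
    by (rule wp_countdown[where I=I, OF that _ step]) (auto simp: I_def)
  have init: "I N r' h'" if "r' 22 = N" "keep 20 r r'" "r' 20 = 64" "r' 21 = 124 + N"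
    "\<forall>j<60. h' (64 + N + j) = bs ! j" "\<forall>a. a < 64 + N \<or> 64 + N + 60 \<le> a \<longrightarrow> h' a = h a" for r' h'
    using that by (auto simp: I_def)
  let ?rest = "Blk [LoadConst 20 64, LoadConst 21 60, Add 21 21 6, LoadConst 22 0, Add 22 22 12] ;;
     While [] 22 ?c"
  have rest: "wp ?rest (N * 8 + 6) ?Q r1 h1"
    if "keep 20 r r1" and h1: "\<forall>j<60. h1 (64 + N + j) = bs ! j"
      "\<forall>a. a < 64 + N \<or> 64 + N + 60 \<le> a \<longrightarrow> h1 a = h a" for r1 h1
  proof -
    have "r1 6 = 64 + N" "r1 12 = N" using that(1) r by (simp_all add: keep_def)
    moreover have "wp (While [] 22 ?c) (N * 8 + 1) ?Q r' h1"
      if "r' 22 = N" "keep 20 r r'" "r' 20 = 64" "r' 21 = 124 + N" for r'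
      by (rule loop, rule init) (use that h1 in simp_all)
    ultimately have "vc (Blk [LoadConst 20 64, LoadConst 21 60, Add 21 21 6, LoadConst 22 0, Add 22 22 12])
        (wp (While [] 22 ?c) (N * 8 + 1) ?Q) r1 h1"
      using that(1) by simp
    then show ?thesis by (rule wp_vc_Seq) simp
  qed
  have unp: "vc (unpack_prog (length bs)) (wp ?rest (N * 8 + 6) ?Q) r1 h"
    if "keep 20 r r1" "r1 20 = 64 + N" "r1 23 = bin bs" for r1
    by (rule vc_unpack_prog[of bs r1 "64 + N" r])
      (use that bs r rest in \<open>auto simp: keep_def\<close>)
  have "vc (Blk [LoadConst 20 0, Add 20 20 6, LoadConst 23 0, Add 23 23 4])
      (wp (unpack_prog 60 ;; ?rest) (N * 8 + 666) ?Q) r h"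
  proof -
    have "wp (unpack_prog 60 ;; ?rest) (N * 8 + 666) ?Q r1 h"
      if "keep 20 r r1" "r1 20 = 64 + N" "r1 23 = bin bs" for r1
      by (rule wp_vc_Seq[OF unp[OF that, unfolded bs(1)]]) simp
    then show ?thesis using r by simp
  qed
  then show ?thesis unfolding copy_prog_def by (rule wp_vc_Seq) simp
qed

section \<open>Setting up the memory layout\<close>

text \<open>With truncated subtraction, \<open>k - (k - \<tau>)\<close> is the minimum of
  \<open>k\<close> and \<tau>. The two loops compute the bits per snapshot as the sum of all numbers
  below \<open>n\<close>, and their multiple by \<tau>.\<close>

definition bases_prog :: com where
  "bases_prog =
     Blk [Sub 20 2 1, Sub 2 2 20, Add 2 2 2, Add 3 3 5, LoadConst 11 0, LoadConst 20 0, Add 20 20 0] ;;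
     While [] 20 (Blk [Sub 20 20 5, Add 11 11 20]) ;;
     Blk [LoadConst 12 0, LoadConst 20 0, Add 20 20 1] ;;
     While [] 20 (Blk [Sub 20 20 5, Add 12 12 11]) ;;
     Blk [LoadConst 20 64, Add 6 20 12, LoadConst 20 60, Add 7 6 20, Add 7 7 12, Add 8 7 0, Add 9 8 0]"

lemma row_start_total: "row_start n n = (\<Sum>i<n. i)"
  unfolding row_start_def by (rule sum.nat_diff_reindex)

lemma wp_bases_prog:
  assumes r: "r 0 = n" "r 1 = \<tau>" "r 2 = k" "r 3 = L" "r 5 = 1" and M: "M = row_start n n"
  shows "wp bases_prog (n * 5 + \<tau> * 5 + 19) (\<lambda>r' h'. h' = h \<and> r' 0 = n \<and> r' 1 = \<tau> \<and>
    r' 2 = 2 * min k \<tau> \<and> r' 3 = Suc L \<and> r' 4 = r 4 \<and> r' 5 = 1 \<and> r' 6 = 64 + \<tau> * M \<and>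
    r' 7 = 124 + \<tau> * M + \<tau> * M \<and> r' 8 = r' 7 + n \<and> r' 9 = r' 8 + n \<and> r' 11 = M \<and> r' 12 = \<tau> * M) r h"
proof -
  let ?Q = "\<lambda>r' h'. h' = h \<and> r' 0 = n \<and> r' 1 = \<tau> \<and>
    r' 2 = 2 * min k \<tau> \<and> r' 3 = Suc L \<and> r' 4 = r 4 \<and> r' 5 = 1 \<and> r' 6 = 64 + \<tau> * M \<and>
    r' 7 = 124 + \<tau> * M + \<tau> * M \<and> r' 8 = r' 7 + n \<and> r' 9 = r' 8 + n \<and> r' 11 = M \<and> r' 12 = \<tau> * M"
  define S where "S r' h' \<longleftrightarrow> h' = h \<and> r' 0 = n \<and> r' 1 = \<tau> \<and> r' 2 = 2 * min k \<tau> \<and> r' 3 = Suc L \<and>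
    r' 4 = r 4 \<and> r' 5 = 1" for r' h' :: "nat \<Rightarrow> nat"
  let ?c1 = "Blk [Sub 20 20 5, Add 11 11 20]" and ?c2 = "Blk [Sub 20 20 5, Add 12 12 11]"
  let ?b1 = "Blk [LoadConst 12 0, LoadConst 20 0, Add 20 20 1]"
  let ?b2 = "Blk [LoadConst 20 64, Add 6 20 12, LoadConst 20 60, Add 7 6 20, Add 7 7 12, Add 8 7 0, Add 9 8 0]"
  define I where "I i r' h' \<longleftrightarrow> S r' h' \<and> r' 20 = i \<and> r' 11 + (\<Sum>j<i. j) = M" for i r' h'
  define J where "J i r' h' \<longleftrightarrow> S r' h' \<and> r' 20 = i \<and> r' 11 = M \<and> r' 12 + i * M = \<tau> * M" for i r' h'
  have 2: "wp (While [] 20 ?c2) (\<tau> * 5 + 1) (wp ?b2 7 ?Q) r1 h1" if "J \<tau> r1 h1" for r1 h1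
  proof (rule wp_countdown[where I=J, OF that])
    show "wp ?c2 2 (\<lambda>r h. J i (r(63 := 0)) h) r1 h1" if "J (Suc i) r1 h1" for i r1 h1
      using that by (intro wp_vc_le) (auto simp: J_def S_def)
    show "wp ?b2 7 ?Q r1 h1" if "J 0 r1 h1" for r1 h1
      using that by (intro wp_vc_le) (auto simp: J_def S_def)
  qed (auto simp: J_def)
  have 1: "wp (While [] 20 ?c1) (n * 5 + 1) (wp (?b1 ;; While [] 20 ?c2 ;; ?b2) (\<tau> * 5 + 11) ?Q) r1 h1"
    if "I n r1 h1" for r1 h1
  proof (rule wp_countdown[where I=I, OF that])
    show "wp ?c1 2 (\<lambda>r h. I i (r(63 := 0)) h) r1 h1" if "I (Suc i) r1 h1" for i r1 h1
      using that by (intro wp_vc_le) (auto simp: I_def S_def)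
    show "wp (?b1 ;; While [] 20 ?c2 ;; ?b2) (\<tau> * 5 + 11) ?Q r1 h1" if I: "I 0 r1 h1" for r1 h1
    proof -
      have "wp (While [] 20 ?c2 ;; ?b2) (\<tau> * 5 + 8) ?Q r2 h2" if "J \<tau> r2 h2" for r2 h2
        using 2[OF that] by (rule wp_Seq_le) simp
      then have "vc ?b1 (wp (While [] 20 ?c2 ;; ?b2) (\<tau> * 5 + 8) ?Q) r1 h1"
        using I by (simp add: I_def J_def S_def)
      then show ?thesis by (rule wp_vc_Seq) simp
    qed
  qed (auto simp: I_def)
  have "wp (While [] 20 ?c1 ;; ?b1 ;; While [] 20 ?c2 ;; ?b2) (n * 5 + \<tau> * 5 + 12) ?Q r1 h1"
    if "I n r1 h1" for r1 h1
    using 1[OF that] by (rule wp_Seq_le) simp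
  then have "vc (Blk [Sub 20 2 1, Sub 2 2 20, Add 2 2 2, Add 3 3 5, LoadConst 11 0, LoadConst 20 0, Add 20 20 0])
      (wp (While [] 20 ?c1 ;; ?b1 ;; While [] 20 ?c2 ;; ?b2) (n * 5 + \<tau> * 5 + 12) ?Q) r h"
    using r by (simp add: I_def S_def M row_start_total min_def)
  then show ?thesis unfolding bases_prog_def by (rule wp_vc_Seq) simp
qed

text \<open>Puts the odometer into its largest state; the parity cells, still 0, already fit because
  the largest digit is even.\<close>

definition digits_prog :: com where
  "digits_prog =
     Blk [LoadConst 20 0, Add 20 20 7, LoadConst 21 0, Add 21 21 0] ;;
     While [] 21 (Blk [StoreInd 20 2, Add 20 20 5, Sub 21 21 5])"

lemma wp_digits_prog:
  assumes r: "r 0 = n" "r 5 = 1" "r 7 = q" and q: "64 \<le> q"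
  shows "wp digits_prog (n * 6 + 5) (\<lambda>r' h'. keep 20 r r' \<and> (\<forall>v<n. h' (q + v) = r 2) \<and>
    (\<forall>a. a < q \<or> q + n \<le> a \<longrightarrow> h' a = h a)) r h"
proof -
  let ?Q = "\<lambda>r' h'. keep 20 r r' \<and> (\<forall>v<n. h' (q + v) = r 2) \<and>
    (\<forall>a. a < q \<or> q + n \<le> a \<longrightarrow> h' a = h a)"
  let ?c = "Blk [StoreInd 20 2, Add 20 20 5, Sub 21 21 5]"
  define I where "I i r' h' \<longleftrightarrow> r' 21 = i \<and> keep 20 r r' \<and> i \<le> n \<and> r' 20 = q + (n - i) \<and>
    (\<forall>v<n - i. h' (q + v) = r 2) \<and> (\<forall>a. a < q \<or> q + n \<le> a \<longrightarrow> h' a = h a)" for i r' h'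
  have step: "wp ?c 3 (\<lambda>r h. I i (r(63 := 0)) h) r1 h1" if I: "I (Suc i) r1 h1" for i r1 h1
  proof -
    from I have k: "keep 20 r r1" and i: "Suc i \<le> n" and reg: "r1 21 = Suc i" "r1 20 = q + (n - Suc i)"
      and hv: "\<forall>v<n - Suc i. h1 (q + v) = r 2" and fr: "\<forall>a. a < q \<or> q + n \<le> a \<longrightarrow> h1 a = h a"
      by (auto simp: I_def)
    have next_: "I i r' (h1(q + (n - Suc i) := r 2))"
      if "keep 20 r r'" "r' 21 = i" "r' 20 = Suc (q + (n - Suc i))" for r'
    proof -
      have N: "n - i = Suc (n - Suc i)" using i by simp
      show ?thesis unfolding I_def N using that hv fr i by (auto simp: less_Suc_eq)
    qed
    have "r1 5 = 1" "r1 2 = r 2" using k r by (simp_all add: keep_def)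
    then show ?thesis using reg k next_ q by (intro wp_vc_le) simp_all
  qed
  have loop: "wp (While [] 21 ?c) (n * 6 + 1) ?Q r1 h1" if "I n r1 h1" for r1 h1
    by (rule wp_countdown[where I=I, OF that _ step]) (auto simp: I_def)
  have "I n r' h" if "r' 21 = n" "keep 20 r r'" "r' 20 = q" for r'
    using that by (auto simp: I_def)
  then have "wp (While [] 21 ?c) (n * 6 + 1) ?Q r' h" if "r' 21 = n" "keep 20 r r'" "r' 20 = q" for r'
    using that by (intro loop) simp
  then have "vc (Blk [LoadConst 20 0, Add 20 20 7, LoadConst 21 0, Add 21 21 0])
      (wp (While [] 21 ?c) (n * 6 + 1) ?Q) r h"
    using r by simp
  then show ?thesis unfolding digits_prog_def by (rule wp_vc_Seq) simp
qed

definition power_prog :: com where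
  "power_prog =
     Blk [LoadConst 14 1, LoadConst 15 0, Add 15 15 0] ;;
     While [] 15 (mult_step ;; Blk [Sub 15 15 5]) ;;
     Blk [LoadConst 10 0, Add 10 10 14]"

lemma wp_power_prog:
  assumes r: "r 0 = n" "r 2 = d" "r 5 = 1"
  shows "wp power_prog (n * (d * 5 + 11) + 6) (\<lambda>r' h'. h' = h \<and> keep 10 r r' \<and> r' 11 = r 11 \<and>
    r' 10 = Suc d ^ n) r h"
proof -
  let ?Q = "\<lambda>r' h'. h' = h \<and> keep 10 r r' \<and> r' 11 = r 11 \<and> r' 10 = Suc d ^ n"
  let ?c = "mult_step ;; Blk [Sub 15 15 5]"
  let ?e = "Blk [LoadConst 10 0, Add 10 10 14]"
  define I where "I i r' h' \<longleftrightarrow> r' 15 = i \<and> h' = h \<and> keep 14 r r' \<and> i \<le> n \<and> r' 14 = Suc d ^ (n - i)"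
    for i r' h'
  have step: "wp ?c (d * 5 + 8) (\<lambda>r h. I i (r(63 := 0)) h) r1 h1" if I: "I (Suc i) r1 h1" for i r1 h1
  proof -
    from I have k: "keep 14 r r1" and i: "Suc i \<le> n" and reg: "r1 15 = Suc i" "r1 14 = Suc d ^ (n - Suc i)"
      and [simp]: "h1 = h" by (auto simp: I_def)
    have "r1 5 = 1" "r1 2 = d" using k r by (simp_all add: keep_def)
    then show ?thesis
    proof (rule wp_Seq_le[OF wp_mono[OF wp_mult_step order_refl], where T=1], elim conjE)
      fix r2 h2 assume *: "h2 = h1" "r2 14 = r1 14 * Suc d" "keep 14 r1 r2"
        "\<forall>i. 14 < i \<and> i < 20 \<longrightarrow> r2 i = r1 i"
      have k2: "keep 14 r r2" by (rule keep_trans[OF k *(3)]) simp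
      have N: "n - i = Suc (n - Suc i)" using i by simp
      have "I i r' h" if "keep 14 r r'" "r' 15 = i" "r' 14 = r2 14" for r'
        using that i * reg by (simp add: I_def N)
      moreover have "r2 15 = Suc i" using * reg by simp
      moreover have "r2 5 = 1" using k2 r by (simp add: keep_def)
      ultimately show "wp (Blk [Sub 15 15 5]) 1 (\<lambda>r h. I i (r(63 := 0)) h) r2 h2"
        using * k2 by (intro wp_vc_le) simp_all
    qed simp
  qed
  have exit: "wp ?e 2 ?Q r1 h1" if I: "I 0 r1 h1" for r1 h1
  proof -
    have "keep 10 r r1" "r1 11 = r 11" using I by (simp_all add: I_def keep_def)
    then show ?thesis using I by (intro wp_vc_le) (simp_all add: I_def)
  qed
  have loop: "wp (While [] 15 ?c) (n * (d * 5 + 11) + 1) (wp ?e 2 ?Q) r1 h1" if "I n r1 h1" for r1 h1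
    by (rule wp_countdown[where I=I, OF that _ step exit]) (auto simp: I_def)
  have "I n r' h" if "keep 14 r r'" "r' 15 = n" "r' 14 = 1" for r'
    using that by (simp add: I_def)
  then have "wp (While [] 15 ?c ;; ?e) (n * (d * 5 + 11) + 3) ?Q r' h"
    if "keep 14 r r'" "r' 15 = n" "r' 14 = 1" for r'
    using that by (intro wp_Seq_le[OF loop]) simp_all
  then have "vc (Blk [LoadConst 14 1, LoadConst 15 0, Add 15 15 0])
      (wp (While [] 15 ?c ;; ?e) (n * (d * 5 + 11) + 3) ?Q) r h"
    using r by simp
  then show ?thesis unfolding power_prog_def by (rule wp_vc_Seq) simp
qed

section \<open>The input format\<close>

lemma length_concat_map_upt: "length (concat (map f [0..<n])) = (\<Sum>i<n. length (f i))"
  by (induction n) auto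

lemma nth_concat_map_upt:
  assumes "u < n" "j < length (f u)"
  shows "(\<Sum>i<u. length (f i)) + j < length (concat (map f [0..<n])) \<and>
    concat (map f [0..<n]) ! ((\<Sum>i<u. length (f i)) + j) = f u ! j"
  using assms
proof (induction n)
  case (Suc n)
  then show ?case
    by (cases "u = n") (auto simp: nth_append length_concat_map_upt)
qed simp

definition snapshot_bits :: "nat \<Rightarrow> nat set set \<Rightarrow> nat list" where
  "snapshot_bits n E =
     concat (map (\<lambda>u. map (\<lambda>v. if {u, v} \<in> E then 1 else 0) [u+1..<n]) [0..<n])"

lemma encode_eq:
  "encode n \<tau> E k L = [n, \<tau>, k, L] @ concat (map (\<lambda>t. snapshot_bits n (E (Suc t))) [0..<\<tau>])"
proof -
  have "[1..<\<tau> + 1] = map Suc [0..<\<tau>]" by (simp add: map_Suc_upt)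
  then show ?thesis by (simp add: encode_def snapshot_bits_def comp_def)
qed

lemma length_snapshot_bits: "length (snapshot_bits n E) = row_start n n"
  by (simp add: snapshot_bits_def length_concat_map_upt row_start_def)

lemma length_encode: "length (encode n \<tau> E k L) = 4 + \<tau> * row_start n n"
  by (simp add: encode_eq length_concat_map_upt length_snapshot_bits)

lemma snapshot_bits_nth:
  assumes "u < v" "v < n"
  shows "row_start n u + (v - Suc u) < row_start n n"
    "snapshot_bits n E ! (row_start n u + (v - Suc u)) = (if {u, v} \<in> E then 1 else 0)"
  using nth_concat_map_upt[of u n "v - Suc u" "\<lambda>u. map (\<lambda>v. if {u, v} \<in> E then 1 else 0 :: nat) [u+1..<n]"]
    assms length_snapshot_bits[of n E]
  by (simp_all add: snapshot_bits_def row_start_def)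

lemma encode_nth:
  assumes "t < \<tau>" "u < v" "v < n"
  shows "t * row_start n n + row_start n u + (v - Suc u) < \<tau> * row_start n n"
    "encode n \<tau> E k L ! (4 + (t * row_start n n + row_start n u + (v - Suc u))) =
      (if {u, v} \<in> E (Suc t) then 1 else 0)"
  using nth_concat_map_upt[of t \<tau> "row_start n u + (v - Suc u)" "\<lambda>t. snapshot_bits n (E (Suc t))"]
    assms snapshot_bits_nth[OF assms(2,3)]
  by (simp_all add: encode_eq length_concat_map_upt length_snapshot_bits nth_append add.assoc)

lemma encode_le_1: "b \<in> set (drop 4 (encode n \<tau> E k L)) \<Longrightarrow> b \<le> 1"
  by (auto simp: encode_eq snapshot_bits_def split: if_splits)

section \<open>The complete program\<close>

text \<open>Register 5 can receive the constant 1 only after the bit in cell 5 has been packed.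
  Register 20 then holds \<open>n - 1\<close>, which is 0 exactly for \<open>n \<le> 1\<close>. The
  single store through register 9 initialises the table with \<open>L + 1\<close> at the zero
  state.\<close>

definition main_prog :: com where
  "main_prog =
     Blk (pack_code [5..<64] @ [LoadConst 5 1, Sub 20 0 5]) ;;
     If 20
       (bases_prog ;; copy_prog ;; digits_prog ;; power_prog ;; Blk [StoreInd 9 3] ;;
        rounds_prog ;; answer_prog)
       (Blk [LoadConst 0 1])"

definition total_time :: "nat \<Rightarrow> nat \<Rightarrow> nat \<Rightarrow> nat" where
  "total_time n \<tau> d = n * 5 + \<tau> * 5 + 19 + (\<tau> * row_start n n * 8 + 670) + (n * 6 + 5) +
     (n * (d * 5 + 11) + 6) + 1 + (\<tau> * (round_time n d + 3) + 5) + (Suc d ^ n * 7 + 6)"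

lemma state_index_top: "Suc (state_index d n (\<lambda>v. if v < n then d else 0)) = Suc d ^ n"
proof -
  have "Suc (\<Sum>v<n. d * Suc d ^ v) = Suc d ^ n" by (induction n) auto
  then show ?thesis by (simp add: state_index_def)
qed

lemma wp_tables:
  assumes n: "2 \<le> n" and m: "\<And>a. 4 + \<tau> * M \<le> a \<Longrightarrow> m a = 0" "\<And>a. 4 \<le> a \<Longrightarrow> m a \<le> 1"
    and M: "M = row_start n n"
    and bits: "\<And>t u v. t < \<tau> \<Longrightarrow> u < v \<Longrightarrow> v < n \<Longrightarrow>
       m (4 + (t * M + row_start n u + (v - Suc u))) = (if {u, v} \<in> E (Suc t) then 1 else 0)"
    and r: "r 0 = n" "r 1 = \<tau>" "r 2 = 2 * K" "r 3 = Suc L" "r 4 = bin bs" "r 5 = 1"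
      "r 6 = 64 + \<tau> * M" "r 7 = 124 + \<tau> * M + \<tau> * M" "r 8 = r 7 + n" "r 9 = r 8 + n"
      "r 11 = M" "r 12 = \<tau> * M"
    and bs_eq: "bs = map m [4..<64]" and d_eq: "d = 2 * K"
  shows "wp (copy_prog ;; digits_prog ;; power_prog ;; Blk [StoreInd 9 3] ;; rounds_prog ;; answer_prog)
    ((\<tau> * M * 8 + 670) + (n * 6 + 5) + (n * (d * 5 + 11) + 6) + 1 + (\<tau> * (round_time n d + 3) + 5)
      + (Suc d ^ n * 7 + 6))
    (\<lambda>r' h'. (r' 0 \<noteq> 0) = (\<exists>x. valid d n x \<and> budget n E L \<tau> x \<noteq> 0)) r m"
proof -
  define N where "N = \<tau> * M"
  define bD where "bD = 124 + N + N"
  interpret layout n \<tau> d M "64 + N" bD "bD + n" "bD + n + n"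
    by unfold_locales (use n d_eq in \<open>auto simp: bD_def\<close>)
  let ?Q = "\<lambda>r' h'. (r' 0 \<noteq> 0) = (\<exists>x. valid d n x \<and> budget n E L \<tau> x \<noteq> 0)"
  have rs: "r 0 = n" "r 1 = \<tau>" "r 2 = d" "r 3 = Suc L" "r 5 = 1" "r 6 = 64 + N" "r 7 = bD"
    "r 8 = bD + n" "r 9 = bD + n + n" "r 11 = M"
    using r(1-3) r(4,6-11) d_eq by (simp_all add: N_def bD_def)
  have rounds: "wp (rounds_prog ;; answer_prog) (\<tau> * (round_time n d + 3) + 5 + (Suc d ^ n * 7 + 6)) ?Q r1 h1"
    if "static r1" "full h1" "table h1 (budget n E L 0)"
      "\<And>t. t < \<tau> \<Longrightarrow> snapshot h1 (64 + N + t * M) (E (Suc t))" for r1 h1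
    by (rule wp_Seq, rule wp_mono[OF wp_rounds[OF that] order_refl])
      (assumption, elim conjE, rule wp_answer)
  have store: "wp (Blk [StoreInd 9 3] ;; rounds_prog ;; answer_prog)
      (1 + (\<tau> * (round_time n d + 3) + 5 + (Suc d ^ n * 7 + 6))) ?Q r1 h1"
    if r1: "static r1" "r1 3 = Suc L"
      and bits1: "\<And>j. j < 60 + N \<Longrightarrow> h1 (64 + N + j) = m (4 + j)"
      and dig1: "\<And>v. v < n \<Longrightarrow> h1 (bD + v) = d" and zero: "\<And>a. bD + n \<le> a \<Longrightarrow> h1 a = 0" for r1 h1
  proof -
    let ?h = "h1(bD + n + n := Suc L)"
    let ?x = "\<lambda>v. if v < n then d else 0"
    have "digits ?h ?x" using dig1 zero d by (auto simp: digits_def)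
    moreover have "valid d n ?x" by (simp add: valid_def)
    ultimately have full: "full ?h" using state_index_top[of d n] unfolding full_def by blast
    \<comment> \<open>Apart from the entry just written the table region is still zero, and only the
      zero state has index 0; this is the table for time 0.\<close>
    have tab: "table ?h (budget n E L 0)"
      unfolding table_def
    proof (intro allI impI)
      fix y assume y: "valid d n y"
      have "state_index d n y = 0 \<longleftrightarrow> y = (\<lambda>_. 0)"
        using state_index_inj[OF y, of "\<lambda>_. 0"] by (auto simp: state_index_def valid_def)
      then show "?h (bD + n + n + state_index d n y) = budget n E L 0 y" using zero by auto
    qed
    have snap: "snapshot ?h (64 + N + t * M) (E (Suc t))" if t: "t < \<tau>" for t
      unfolding snapshot_def
    proof (intro conjI allI impI)
      fix u v assume uv: "u < v" "v < n"
      define j where "j = t * M + row_start n u + (v - Suc u)"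
      have j: "j < N" using encode_nth(1)[OF t uv] by (simp add: j_def N_def M)
      have eq: "64 + N + t * M + row_start n u + (v - Suc u) = 64 + N + j" by (simp add: j_def)
      show "64 + N + t * M + row_start n u + (v - Suc u) < bD" using j unfolding eq bD_def by simp
      have "?h (64 + N + j) = m (4 + j)" using bits1[of j] j by (simp add: bD_def)
      then show "?h (64 + N + t * M + row_start n u + (v - Suc u)) = (if {u, v} \<in> E (Suc t) then 1 else 0)"
        unfolding eq using bits[OF t uv] by (simp add: j_def)
    qed simp
    have "r1 9 = bD + n + n" using r1(1) by (simp add: static_def)
    then have "vc (Blk [StoreInd 9 3]) (wp (rounds_prog ;; answer_prog)
        (\<tau> * (round_time n d + 3) + 5 + (Suc d ^ n * 7 + 6)) ?Q) r1 h1"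
      using rounds[OF r1(1) full tab snap] base r1(2) by simp
    then show ?thesis by (rule wp_vc_Seq) simp
  qed
  have power: "wp (power_prog ;; Blk [StoreInd 9 3] ;; rounds_prog ;; answer_prog)
      (n * (d * 5 + 11) + 6 + (1 + (\<tau> * (round_time n d + 3) + 5 + (Suc d ^ n * 7 + 6)))) ?Q r1 h1"
    if k: "keep 20 r r1" 
      and h1: "\<And>j. j < 60 + N \<Longrightarrow> h1 (64 + N + j) = m (4 + j)"
      "\<And>v. v < n \<Longrightarrow> h1 (bD + v) = d" "\<And>a. bD + n \<le> a \<Longrightarrow> h1 a = 0" for r1 h1
  proof -
    have r1: "r1 0 = n" "r1 2 = d" "r1 5 = 1" using k rs by (simp_all add: keep_def)
    show ?thesis
    proof (rule wp_Seq, rule wp_mono[OF wp_power_prog[OF r1] order_refl], elim conjE)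
      fix r2 h2 assume *: "h2 = h1" "keep 10 r1 r2" "r2 11 = r1 11" "r2 10 = Suc d ^ n"
      have "static r2" "r2 3 = Suc L"
        using * k rs by (simp_all add: static_def keep_def)
      then show "wp (Blk [StoreInd 9 3] ;; rounds_prog ;; answer_prog)
          (1 + (\<tau> * (round_time n d + 3) + 5 + (Suc d ^ n * 7 + 6))) ?Q r2 h2"
        unfolding \<open>h2 = h1\<close> by (rule store) (use h1 in auto)
    qed
  qed
  have digs: "wp (digits_prog ;; power_prog ;; Blk [StoreInd 9 3] ;; rounds_prog ;; answer_prog)
      (n * 6 + 5 + (n * (d * 5 + 11) + 6 + (1 + (\<tau> * (round_time n d + 3) + 5 + (Suc d ^ n * 7 + 6))))) ?Q r1 h1"
    if k: "keep 20 r r1"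
      and h1: "\<And>j. j < 60 + N \<Longrightarrow> h1 (64 + N + j) = m (4 + j)" "\<And>a. bD \<le> a \<Longrightarrow> h1 a = 0" for r1 h1
  proof -
    have r1: "r1 0 = n" "r1 5 = 1" "r1 7 = bD" "r1 2 = d"
      using k rs by (simp_all add: keep_def)
    show ?thesis
    proof (rule wp_Seq, rule wp_mono[OF wp_digits_prog[OF r1(1-3) base(1)] order_refl], elim conjE)
      fix r2 h2 assume *: "keep 20 r1 r2" "\<forall>v<n. h2 (bD + v) = r1 2"
        "\<forall>a. a < bD \<or> bD + n \<le> a \<longrightarrow> h2 a = h1 a"
      show "wp (power_prog ;; Blk [StoreInd 9 3] ;; rounds_prog ;; answer_prog)
          (n * (d * 5 + 11) + 6 + (1 + (\<tau> * (round_time n d + 3) + 5 + (Suc d ^ n * 7 + 6)))) ?Q r2 h2"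
      proof (rule power)
        show "keep 20 r r2" by (rule keep_trans[OF k *(1)]) simp
        show "h2 (64 + N + j) = m (4 + j)" if "j < 60 + N" for j
          using *(3) h1(1)[OF that] that by (simp add: bD_def)
      qed (use * h1 r1 in auto)
    qed
  qed
  have bs: "length bs = 60" "\<forall>b\<in>set bs. b \<le> 1" unfolding bs_eq using m(2) by auto
  have rN: "r 6 = 64 + N" "r 12 = N" using r by (simp_all add: N_def)
  show ?thesis
  proof (rule wp_Seq_le[OF wp_mono[OF wp_copy_prog[OF r(5,6) rN bs] order_refl]], elim conjE)
    fix r2 h2 assume *: "keep 20 r r2" "\<forall>j<60. h2 (64 + N + j) = bs ! j"
      "\<forall>j<N. h2 (64 + N + 60 + j) = m (64 + j)" "\<forall>a\<ge>64 + N + 60 + N. h2 a = m a"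
    show "wp (digits_prog ;; power_prog ;; Blk [StoreInd 9 3] ;; rounds_prog ;; answer_prog)
      (n * 6 + 5 + (n * (d * 5 + 11) + 6 + (1 + (\<tau> * (round_time n d + 3) + 5 + (Suc d ^ n * 7 + 6))))) ?Q r2 h2"
    proof (rule digs[OF *(1)])
      show "h2 (64 + N + j) = m (4 + j)" if "j < 60 + N" for j
      proof (cases "j < 60")
        case True
        then have "h2 (64 + N + j) = bs ! j" using *(2) by simp
        also have "bs ! j = m (4 + j)"
          unfolding bs_eq using True by (subst nth_map) (simp_all del: upt_rec_numeral)
        finally show ?thesis .
      next
        case False
        then obtain i where i: "j = 60 + i" by (metis le_Suc_ex not_less)
        then have "h2 (64 + N + 60 + i) = m (64 + i)" using *(3) that by simp
        then show ?thesis unfolding i by (simp add: add.assoc)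
      qed
      show "h2 a = 0" if "bD \<le> a" for a
      proof -
        have "64 + N + 60 + N \<le> a" using that by (simp add: bD_def)
        moreover from this have "m a = 0" by (intro m(1)) (simp flip: N_def)
        ultimately show ?thesis using *(4) by simp
      qed
    qed
  qed (simp add: N_def)
qed

lemma bin_pack: "foldl (\<lambda>a b. 2 * a + b) (m 4) (map m [5..<64]) = bin (map m [4..<64])"
proof -
  have "[4..<64] = 4 # [5..<64]" by (subst upt_conv_Cons) (simp_all del: upt_rec_numeral)
  then show ?thesis unfolding foldl_bin by (simp del: upt_rec_numeral)
qed

text \<open>The constant 124 consists of 118 steps for packing 59 cells, two further instructions,
  and four for the conditional with its trivial branch. The initial memory serves as register file
  and as heap.\<close>

theorem wp_main_prog:
  assumes G: "temporal_graph {0..<n} \<tau> E"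
  shows "wp main_prog (if n \<le> 1 then 124 else total_time n \<tau> (2 * min k \<tau>) + 124)
    (\<lambda>r h. (r 0 \<noteq> 0) = MinTimeline_plus {0..<n} \<tau> E k L)
    (snd (init (encode n \<tau> E k L))) (snd (init (encode n \<tau> E k L)))"
proof -
  let ?xs = "encode n \<tau> E k L"
  define m where "m = snd (init ?xs)"
  define M where "M = row_start n n"
  define B where "B = bin (map m [4..<64])"
  let ?Q = "\<lambda>r h. (r 0 \<noteq> 0) = MinTimeline_plus {0..<n} \<tau> E k L"
  have m: "m i = (if i < length ?xs then ?xs ! i else 0)" for i by (simp add: m_def init_def)
  have params: "m 0 = n" "m 1 = \<tau>" "m 2 = k" "m 3 = L" by (simp_all add: m encode_eq)
  have le_1: "m a \<le> 1" if "4 \<le> a" for a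
  proof (cases "a < length ?xs")
    case True
    then have eq: "?xs ! a = drop 4 ?xs ! (a - 4)" and "a - 4 < length (drop 4 ?xs)" using that by auto
    have "drop 4 ?xs ! (a - 4) \<in> set (drop 4 ?xs)" by (rule nth_mem) fact
    from encode_le_1[OF this] show ?thesis using True unfolding m eq[symmetric] by simp
  qed (simp add: m)
  have zero: "m a = 0" if "4 + \<tau> * M \<le> a" for a using that by (simp add: m length_encode M_def)
  have bits: "m (4 + (t * M + row_start n u + (v - Suc u))) = (if {u, v} \<in> E (Suc t) then 1 else 0)"
    if "t < \<tau>" "u < v" "v < n" for t u v
    using encode_nth(1)[OF that] encode_nth(2)[OF that, where E=E and k=k and L=L] unfolding M_def by (simp add: m length_encode)
  let ?main = "bases_prog ;; copy_prog ;; digits_prog ;; power_prog ;; Blk [StoreInd 9 3] ;;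
        rounds_prog ;; answer_prog"
  let ?d = "2 * min k \<tau>"
  have main: "wp ?main (total_time n \<tau> ?d) ?Q r1 m"
    if n: "2 \<le> n" and r1: "r1 0 = n" "r1 1 = \<tau>" "r1 2 = k" "r1 3 = L" "r1 5 = 1"
      "r1 4 = B" for r1
  proof (rule wp_Seq_le[OF wp_mono[OF wp_bases_prog[OF r1(1-5) M_def] order_refl]], elim conjE)
    fix r2 h2 :: "nat \<Rightarrow> nat" assume *: "h2 = m" "r2 0 = n" "r2 1 = \<tau>" "r2 2 = 2 * min k \<tau>" "r2 3 = Suc L" "r2 4 = r1 4"
      "r2 5 = 1" "r2 6 = 64 + \<tau> * M" "r2 7 = 124 + \<tau> * M + \<tau> * M" "r2 8 = r2 7 + n" "r2 9 = r2 8 + n"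
      "r2 11 = M" "r2 12 = \<tau> * M"
    have "MinTimeline_plus {0..<n} \<tau> E k L \<longleftrightarrow> (\<exists>x. valid ?d n x \<and> budget n E L \<tau> x \<noteq> 0)"
      unfolding MinTimeline_plus_iff_budget[OF G] valid_def conj_assoc ..
    then show "wp (copy_prog ;; digits_prog ;; power_prog ;; Blk [StoreInd 9 3] ;; rounds_prog ;; answer_prog)
      ((\<tau> * M * 8 + 670) + (n * 6 + 5) + (n * (?d * 5 + 11) + 6) + 1 + (\<tau> * (round_time n ?d + 3) + 5)
      + (Suc ?d ^ n * 7 + 6)) ?Q r2 h2"
      using wp_tables[OF n zero le_1 M_def bits *(2-5) *(6)[unfolded r1(6) B_def] *(7-13) refl refl]
      unfolding *(1) by simp
  qed (simp add: total_time_def M_def)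
  let ?r = "m(4 := B, 5 := 1, 20 := n - 1)"
  let ?T = "if n \<le> 1 then 1 else total_time n \<tau> ?d"
  have triv: "MinTimeline_plus {0..<n} \<tau> E k L" if "n \<le> 1"
    unfolding MinTimeline_plus_iff_budget[OF G]
  proof (intro exI conjI)
    have cov: "covers_at n (E t) x" for t x using that by (auto simp: covers_at_def)
    have "budget n E L t (\<lambda>_. 0) \<noteq> 0" for t
    proof -
      have "is_path n E t (\<lambda>_ _. 0) (\<lambda>_ _. 0)" using cov by (simp add: is_path_def digit_step_def)
      then have "0 < budget n E L t (\<lambda>_. 0)"
        unfolding less_budget_iff by (intro exI[of _ "\<lambda>_ _. 0"]) simp
      then show ?thesis by simp
    qed
    then show "budget n E L \<tau> (\<lambda>_. 0) \<noteq> 0" .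
  qed auto
  have "wp (If 20 ?main (Blk [LoadConst 0 1])) (if n \<le> 1 then 4 else total_time n \<tau> ?d + 4) ?Q ?r m"
  proof (cases "n \<le> 1")
    case True
    have "wp (If 20 ?main (Blk [LoadConst 0 1])) (0 + 1 + 3) ?Q ?r m"
      by (rule wp_If) (use True triv in \<open>auto intro!: wp_vc_le\<close>)
    then show ?thesis using True by simp
  next
    case False
    have "wp (If 20 ?main (Blk [LoadConst 0 1])) (total_time n \<tau> ?d + 1 + 3) ?Q ?r m"
    proof (rule wp_If)
      have "wp ?main (total_time n \<tau> ?d) ?Q ?r m"
        by (rule main) (use False params in \<open>simp_all del: upt_rec_numeral\<close>)
      then show "wp ?main (total_time n \<tau> ?d) (\<lambda>r. ?Q (r(63 := 0))) ?r m" by simp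
    qed (use False in auto)
    then show ?thesis using False by (simp add: add.commute)
  qed
  moreover have "blk (pack_code [5..<64] @ [LoadConst 5 1, Sub 20 0 5]) Q m m \<longleftrightarrow> Q ?r m" for Q
  proof -
    have "\<forall>j\<in>set [5..<64]. j < 64 \<and> j \<noteq> (4::nat)" by (simp only: set_upt) auto
    then show ?thesis
      unfolding blk_append by (subst blk_pack_code) (simp_all add: bin_pack[of m, folded B_def] params del: upt_rec_numeral)
  qed
  ultimately have "vc (Blk (pack_code [5..<64] @ [LoadConst 5 1, Sub 20 0 5]))
     (wp (If 20 ?main (Blk [LoadConst 0 1])) (if n \<le> 1 then 4 else total_time n \<tau> ?d + 4) ?Q) m m"
    by (simp only: vc.simps)
  then show ?thesis unfolding main_prog_def m_def[symmetric]
    by (rule wp_vc_Seq) (simp del: upt_rec_numeral)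
qed

section \<open>Time bounds\<close>

lemma row_start_le: "row_start n n \<le> n * n"
proof -
  have "(\<Sum>i<n. i) \<le> (\<Sum>i<n. n)" by (intro sum_mono) auto
  then show ?thesis by (simp add: row_start_total)
qed

text \<open>Every term is a product of a factor up to \<open>n * n\<close>, one up to
  \<open>Suc d ^ n\<close> and one up to \<tau>, so all are dominated by the same product; 2000
  generously absorbs the coefficients.\<close>

lemma total_time_le:
  assumes n: "1 \<le> n" and \<tau>: "1 \<le> \<tau>"
  shows "total_time n \<tau> d + 124 \<le> 2000 * (n * n * Suc d ^ n * \<tau>)"
proof -
  define P where "P = Suc d ^ n"
  define Y where "Y = n * n * P * \<tau>"
  have P: "1 \<le> P" "d \<le> P"
  proof -
    have "Suc d ^ 1 \<le> P" unfolding P_def using n by (intro power_increasing) auto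
    then show "1 \<le> P" "d \<le> P" by simp_all
  qed
  have nn: "1 \<le> n * n" "n \<le> n * n" using n by auto
  have mono: "a * b * c \<le> Y" if "a \<le> n * n" "b \<le> P" "c \<le> \<tau>" for a b c
    unfolding Y_def using that by (intro mult_mono) auto
  have row: "\<tau> * row_start n n \<le> Y"
    using mono[OF row_start_le P(1) order_refl] by (simp add: mult.commute)
  have round: "\<tau> * (n * (P * (n * 18 + 35) + d * 5 + 15) + P * (n * (n * 17 + 28) + 19) + 13) \<le> 220 * Y"
    using mono[OF order_refl order_refl order_refl] mono[OF nn(2) order_refl order_refl]
      mono[OF nn(1) order_refl order_refl] mono[OF nn(2) P(2) order_refl]
      mono[OF nn(2) P(1) order_refl] mono[OF nn(1) P(1) order_refl]
    by (simp add: algebra_simps)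
  have "n \<le> Y" "\<tau> \<le> Y" "1 \<le> Y" "n * d \<le> Y" "P \<le> Y"
    using mono[OF nn(2) P(1) \<tau>] mono[OF nn(1) P(1) order_refl] mono[OF nn(1) P(1) \<tau>]
      mono[OF nn(2) P(2) \<tau>] mono[OF nn(1) order_refl \<tau>] by simp_all
  then have "total_time n \<tau> d + 124 \<le> 2000 * Y"
    using row round unfolding total_time_def round_time_def P_def[symmetric]
    by (simp add: algebra_simps)
  then show ?thesis by (simp add: Y_def P_def)
qed

text \<open>The exponent 14 is 11 + 3: \<open>2000 \<le> 2 ^ 11\<close>, the factor
  \<open>n * n\<close> contributes two powers \<open>2 ^ n\<close>, and
  \<open>Suc (2 * K) \<le> 2 * (K + 1)\<close> contributes a third.\<close>

lemma run_time_le: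
  assumes n: "2 \<le> n" and \<tau>: "1 \<le> \<tau>"
  shows "total_time n \<tau> (2 * K) + 124 \<le> (K + 1) ^ n * 2 ^ (14 * (n + 1)) * \<tau>"
proof -
  have "n \<le> 2 ^ n" by (simp add: less_imp_le)
  have "Suc (2 * K) ^ n \<le> (2 * (K + 1)) ^ n" by (intro power_mono) auto
  then have P: "Suc (2 * K) ^ n \<le> 2 ^ n * (K + 1) ^ n" by (simp only: power_mult_distrib)
  have "(2000::nat) \<le> 2 ^ 11" by simp
  also have "\<dots> \<le> 2 ^ (11 * (n + 1))" by (intro power_increasing) auto
  finally have "2000 * (n * n * Suc (2 * K) ^ n * \<tau>) \<le>
      2 ^ (11 * (n + 1)) * (2 ^ n * 2 ^ n * (2 ^ n * (K + 1) ^ n) * \<tau>)"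
    using \<open>n \<le> 2 ^ n\<close> P by (intro mult_mono) auto
  also have "\<dots> = 2 ^ (11 * (n + 1) + (n + n + n)) * (K + 1) ^ n * \<tau>"
    by (simp only: power_add mult_ac)
  also have "\<dots> \<le> 2 ^ (14 * (n + 1)) * (K + 1) ^ n * \<tau>"
    by (intro mult_right_mono power_increasing) auto
  finally have "2000 * (n * n * Suc (2 * K) ^ n * \<tau>) \<le> 2 ^ (14 * (n + 1)) * (K + 1) ^ n * \<tau>" .
  moreover have "total_time n \<tau> (2 * K) + 124 \<le> 2000 * (n * n * Suc (2 * K) ^ n * \<tau>)"
    using n \<tau> by (intro total_time_le) auto
  ultimately show ?thesis by (simp only: mult.commute[of "(K + 1) ^ n"])
qed

text \<open>The bound retains \<open>min k \<tau>\<close>: estimating it by \<open>k\<close> serves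
  the explicit and the fixed-parameter bound, estimating it by \<tau> the XP bound.\<close>

lemma decides_main_prog:
  assumes G: "temporal_graph {0..<n} \<tau> E"
    and T: "(if n \<le> 1 then 2 ^ (14 * (n + 1)) else (min k \<tau> + 1) ^ n * 2 ^ (14 * (n + 1)) * \<tau>) \<le> T"
  shows "decides_within (comp 0 main_prog) (encode n \<tau> E k L) T (MinTimeline_plus {0..<n} \<tau> E k L)"
proof (rule decides_withinI)
  let ?m = "snd (init (encode n \<tau> E k L))"
  have "(124::nat) \<le> 2 ^ 14" by simp
  also have "\<dots> \<le> 2 ^ (14 * (n + 1))" by (intro power_increasing) auto
  finally have "(if n \<le> 1 then 124 else total_time n \<tau> (2 * min k \<tau>) + 124) \<le> T"
    using T run_time_le[of n \<tau> "min k \<tau>"] G by (auto simp: temporal_graph_def simp del: power_Suc)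
  then show "wp main_prog T (\<lambda>r h. (r 0 \<noteq> 0) = MinTimeline_plus {0..<n} \<tau> E k L) ?m ?m"
    by (rule wp_mono[OF wp_main_prog[OF G]])
  show "?m = memory ?m ?m" by (simp add: memory_def)
qed

lemma length_le_input_size: "length xs \<le> input_size xs"
proof (induction xs)
  case (Cons x xs)
  have "1 \<le> bitlen x" by (subst bitlen.simps) simp
  with Cons show ?case by (simp add: input_size_def del: bitlen.simps)
qed (simp add: input_size_def)

text \<open>Each list entry has bit length at least one, and two vertices already give every
  snapshot at least one bit.\<close>

lemma input_size_encode:
  "4 \<le> input_size (encode n \<tau> E k L)"
  "2 \<le> n \<Longrightarrow> \<tau> + 4 \<le> input_size (encode n \<tau> E k L)"
proof -
  have len: "4 + \<tau> * row_start n n \<le> input_size (encode n \<tau> E k L)"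
    using length_le_input_size[of "encode n \<tau> E k L"] by (simp add: length_encode)
  then show "4 \<le> input_size (encode n \<tau> E k L)" by simp
  assume "2 \<le> n"
  then have "1 \<le> row_start n n"
    using member_le_sum[of 0 "{..<n}" "\<lambda>i. n - Suc i"] by (simp add: row_start_def)
  then have "\<tau> * 1 \<le> \<tau> * row_start n n" by (intro mult_left_mono) auto
  with len show "\<tau> + 4 \<le> input_size (encode n \<tau> E k L)" by linarith
qed

section \<open>Computability of the parameter functions\<close>

lemma computable_linear: "computable_fun (\<lambda>n. 15 * (n + 1))"
proof (rule computable_funI)
  fix p :: nat and r :: "nat \<Rightarrow> nat" assume "r 0 = p"
  then show "\<exists>T. wp (Blk [LoadConst 1 1, Add 0 0 1, Add 1 0 0, Add 1 1 0, Add 2 1 1, Add 2 2 2, Add 0 2 1])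
      T (\<lambda>r h. r 0 = 15 * (p + 1)) r (\<lambda>_. 0)"
    by (intro exI[of _ 7] wp_vc_le) simp_all
qed

text \<open>Two loops of doublings: the first turns 15 into the exponent \<open>15 * 2 ^ p\<close>,
  which the second uses as its counter. In both, the current value times \<open>2 ^ i\<close> is
  constant while \<open>i\<close> rounds remain.\<close>

lemma computable_double_exp: "computable_fun (\<lambda>p. 2 ^ (15 * 2 ^ p))"
proof (rule computable_funI)
  fix p :: nat and r :: "nat \<Rightarrow> nat" assume r: "r 0 = p"
  let ?Q = "\<lambda>r h. r 0 = (2::nat) ^ (15 * 2 ^ p)"
  let ?b1 = "Blk [LoadConst 1 1, LoadConst 2 15]" and ?b2 = "Blk [LoadConst 0 1]"
  let ?c1 = "Blk [Add 2 2 2, Sub 0 0 1]" and ?c2 = "Blk [Add 0 0 0, Sub 2 2 1]"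
  define I where "I i r h \<longleftrightarrow> r 0 = i \<and> r 1 = 1 \<and> r 2 * 2 ^ i = 15 * 2 ^ p"
    for i and r h :: "nat \<Rightarrow> nat"
  define J where "J i r h \<longleftrightarrow> r 2 = i \<and> r 1 = 1 \<and> r 0 * 2 ^ i = (2::nat) ^ (15 * 2 ^ p)"
    for i and r h :: "nat \<Rightarrow> nat"
  let ?T = "15 * 2 ^ p * 5 + 1"
  have 2: "wp (While [] 2 ?c2) ?T ?Q r1 h1" if "J (15 * 2 ^ p) r1 h1" for r1 h1
  proof (rule wp_countdown[where I=J, OF that])
    show "wp ?c2 2 (\<lambda>r h. J i (r(63 := 0)) h) r1 h1" if "J (Suc i) r1 h1" for i r1 h1
      using that by (intro wp_vc_le) (simp_all add: J_def mult.assoc mult_2[symmetric] mult.left_commute)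
  qed (auto simp: J_def)
  have 1: "wp (While [] 0 ?c1) (p * 5 + 1) (wp (?b2 ;; While [] 2 ?c2) (1 + ?T) ?Q) r1 h1"
    if "I p r1 h1" for r1 h1
  proof (rule wp_countdown[where I=I, OF that])
    show "wp ?c1 2 (\<lambda>r h. I i (r(63 := 0)) h) r1 h1" if "I (Suc i) r1 h1" for i r1 h1
      using that by (intro wp_vc_le) (simp_all add: I_def mult.assoc mult_2[symmetric] mult.left_commute)
    show "wp (?b2 ;; While [] 2 ?c2) (1 + ?T) ?Q r1 h1" if I: "I 0 r1 h1" for r1 h1
    proof -
      have "J (15 * 2 ^ p) (r1(0 := 1)) h1" using I by (simp add: I_def J_def)
      then have "vc ?b2 (wp (While [] 2 ?c2) ?T ?Q) r1 h1" using 2 by simp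
      then show ?thesis by (rule wp_vc_Seq) simp
    qed
  qed (auto simp: I_def)
  have "I p (r(1 := 1, 2 := 15)) (\<lambda>_. 0)" using r by (simp add: I_def)
  then have "wp (While [] 0 ?c1 ;; ?b2 ;; While [] 2 ?c2) (p * 5 + 1 + (1 + ?T)) ?Q (r(1 := 1, 2 := 15)) (\<lambda>_. 0)"
    by (intro wp_Seq 1)
  then have "vc ?b1 (wp (While [] 0 ?c1 ;; ?b2 ;; While [] 2 ?c2) (p * 5 + 1 + (1 + ?T)) ?Q) r (\<lambda>_. 0)"
    by simp
  then have "wp (?b1 ;; While [] 0 ?c1 ;; ?b2 ;; While [] 2 ?c2) (2 + (p * 5 + 1 + (1 + ?T))) ?Q r (\<lambda>_. 0)"
    by (rule wp_vc_Seq) simp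
  then show "\<exists>T. wp (?b1 ;; While [] 0 ?c1 ;; ?b2 ;; While [] 2 ?c2) T ?Q r (\<lambda>_. 0)" by blast
qed

text \<open>Any computable function of \<open>n + k\<close> is good enough, and a double exponential
  is easy to compute by doubling. Both \<open>k * n\<close> and \<open>n + 1\<close> are at most
  \<open>2 ^ (n + k)\<close>, which gives the factor 1 + 14 = 15.\<close>

lemma exp_bound: "(k + 1) ^ n * 2 ^ (14 * (n + 1)) \<le> (2::nat) ^ (15 * 2 ^ (n + k))"
proof -
  have less: "m + 1 \<le> 2 ^ m" for m :: nat by (simp add: Suc_le_eq)
  have "(k + 1) ^ n * 2 ^ (14 * (n + 1)) \<le> (2 ^ k) ^ n * (2::nat) ^ (14 * (n + 1))"
    using less by (intro mult_right_mono power_mono) auto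
  also have "\<dots> = 2 ^ (k * n + 14 * (n + 1))" by (simp only: power_add power_mult)
  also have "\<dots> \<le> 2 ^ (15 * 2 ^ (n + k))"
  proof (intro power_increasing)
    have "k * n \<le> 2 ^ k * 2 ^ n" using less[of k] less[of n] by (intro mult_mono) auto
    moreover have "(n + 1) * 1 \<le> 2 ^ n * 2 ^ k" using less[of n] by (intro mult_mono) auto
    ultimately show "k * n + 14 * (n + 1) \<le> 15 * 2 ^ (n + k)" by (simp add: power_add mult.commute)
  qed simp
  finally show ?thesis .
qed

text \<open>One program witnesses all three claims; they differ only in how its running time is
  estimated.\<close>

theorem mainTheorem7:
  shows "(\<exists>P c. \<forall>n \<tau> E k L. temporal_graph {0..<n} \<tau> E \<longrightarrow>
            decides_within P (encode n \<tau> E k L)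
              ((k + 1) ^ n * 2 ^ (c * (n + 1)) * \<tau> * (L + 1))
              (MinTimeline_plus {0..<n} \<tau> E k L))
       \<and> (\<exists>P g c. computable_fun g \<and> (\<forall>n \<tau> E k L. temporal_graph {0..<n} \<tau> E \<longrightarrow>
            decides_within P (encode n \<tau> E k L)
              (g (n + k) * input_size (encode n \<tau> E k L) ^ c)
              (MinTimeline_plus {0..<n} \<tau> E k L)))
       \<and> (\<exists>P g. computable_fun g \<and> (\<forall>n \<tau> E k L. temporal_graph {0..<n} \<tau> E \<longrightarrow>
            decides_within P (encode n \<tau> E k L)
              (input_size (encode n \<tau> E k L) ^ g n)
              (MinTimeline_plus {0..<n} \<tau> E k L)))"
proof (intro conjI)
  let ?P = "comp 0 main_prog"
  let ?B = "\<lambda>(n::nat) (k::nat) \<tau>. if n \<le> 1 then 2 ^ (14 * (n + 1)) else (min k \<tau> + 1) ^ n * 2 ^ (14 * (n + 1)) * \<tau>"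
  \<comment> \<open>Here \<open>s\<close> stands for \<open>\<tau> * (L + 1)\<close> in the first
    claim and for the input size in the second.\<close>
  have B: "?B n k \<tau> \<le> (k + 1) ^ n * 2 ^ (14 * (n + 1)) * s" if "n \<le> 1 \<Longrightarrow> 1 \<le> s" "2 \<le> n \<Longrightarrow> \<tau> \<le> s" for n k \<tau> s :: nat
  proof (cases "n \<le> 1")
    case True
    then have "1 * 2 ^ (14 * (n + 1)) * 1 \<le> (k + 1) ^ n * 2 ^ (14 * (n + 1)) * s"
      using that by (intro mult_mono) auto
    then show ?thesis using True by (simp only: if_True mult_1 mult_1_right)
  next
    case False
    then have "(min k \<tau> + 1) ^ n * 2 ^ (14 * (n + 1)) * \<tau> \<le> (k + 1) ^ n * 2 ^ (14 * (n + 1)) * s"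
      using that by (intro mult_mono power_mono) auto
    then show ?thesis using False by (simp only: if_False)
  qed
  show "\<exists>P c. \<forall>n \<tau> E k L. temporal_graph {0..<n} \<tau> E \<longrightarrow>
            decides_within P (encode n \<tau> E k L)
              ((k + 1) ^ n * 2 ^ (c * (n + 1)) * \<tau> * (L + 1))
              (MinTimeline_plus {0..<n} \<tau> E k L)"
  proof (intro exI[of _ ?P] exI[of _ 14] allI impI decides_main_prog)
    fix n \<tau> k L :: nat and E :: "nat \<Rightarrow> nat set set"
    assume "temporal_graph {0..<n} \<tau> E"
    then have "1 \<le> \<tau>" by (simp add: temporal_graph_def)
    then have "?B n k \<tau> \<le> (k + 1) ^ n * 2 ^ (14 * (n + 1)) * (\<tau> * (L + 1))"
      by (intro B) auto
    then show "?B n k \<tau> \<le> (k + 1) ^ n * 2 ^ (14 * (n + 1)) * \<tau> * (L + 1)"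
      by (simp only: mult.assoc)
  qed
  show "\<exists>P g c. computable_fun g \<and> (\<forall>n \<tau> E k L. temporal_graph {0..<n} \<tau> E \<longrightarrow>
            decides_within P (encode n \<tau> E k L)
              (g (n + k) * input_size (encode n \<tau> E k L) ^ c)
              (MinTimeline_plus {0..<n} \<tau> E k L))"
  proof (intro exI[of _ ?P] exI[of _ "\<lambda>p. 2 ^ (15 * 2 ^ p)"] exI[of _ 1] conjI computable_double_exp
      allI impI decides_main_prog)
    fix n \<tau> k L :: nat and E :: "nat \<Rightarrow> nat set set"
    let ?s = "input_size (encode n \<tau> E k L)"
    have "?B n k \<tau> \<le> (k + 1) ^ n * 2 ^ (14 * (n + 1)) * ?s"
      using input_size_encode[of n \<tau> E k L] by (intro B) auto
    also have "\<dots> \<le> 2 ^ (15 * 2 ^ (n + k)) * ?s" by (intro mult_right_mono exp_bound) auto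
    finally show "?B n k \<tau> \<le> 2 ^ (15 * 2 ^ (n + k)) * ?s ^ 1" by (simp only: power_one_right)
  qed
  show "\<exists>P g. computable_fun g \<and> (\<forall>n \<tau> E k L. temporal_graph {0..<n} \<tau> E \<longrightarrow>
            decides_within P (encode n \<tau> E k L)
              (input_size (encode n \<tau> E k L) ^ g n)
              (MinTimeline_plus {0..<n} \<tau> E k L))"
  proof (intro exI[of _ ?P] exI[of _ "\<lambda>n. 15 * (n + 1)"] conjI computable_linear allI impI
      decides_main_prog)
    fix n \<tau> k L :: nat and E :: "nat \<Rightarrow> nat set set"
    let ?s = "input_size (encode n \<tau> E k L)"
    have s: "2 \<le> ?s" using input_size_encode(1)[of n \<tau> E k L] by simp
    have two: "2 ^ (14 * (n + 1)) \<le> ?s ^ (14 * (n + 1))" using s by (intro power_mono) auto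
    show "?B n k \<tau> \<le> ?s ^ (15 * (n + 1))"
    proof (cases "n \<le> 1")
      case True
      have "?s ^ (14 * (n + 1)) \<le> ?s ^ (15 * (n + 1))" using s by (intro power_increasing) auto
      with two have "2 ^ (14 * (n + 1)) \<le> ?s ^ (15 * (n + 1))" by (rule order_trans)
      then show ?thesis using True by (simp only: if_True)
    next
      case False
      then have \<tau>: "\<tau> + 4 \<le> ?s" by (intro input_size_encode) simp
      \<comment> \<open>The input size exceeds \<open>min k \<tau> + 1\<close>, 2 and \<tau>, so
        every factor becomes a power of it; the exponents \<open>n\<close>,
        \<open>14 * (n + 1)\<close> and 1 add up to \<open>15 * (n + 1)\<close>.\<close>
      have "(min k \<tau> + 1) ^ n * 2 ^ (14 * (n + 1)) * \<tau> \<le> ?s ^ n * ?s ^ (14 * (n + 1)) * ?s"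
        using two \<tau> by (intro mult_mono power_mono) auto
      also have "\<dots> = ?s ^ (n + 14 * (n + 1) + 1)" by (simp only: power_add power_one_right)
      also have "n + 14 * (n + 1) + 1 = 15 * (n + 1)" by simp
      finally show ?thesis using False by (simp only: if_False)
    qed
  qed
qed

end
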